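(* Let $K\subset\mathbb{R}$ be a finite union of nondegenerate compact intervals and let $\tau\in(0,1]$. Then, uniformly over $\tau$-Leja sequences $\mathbf{x}\in\mathcal{L}_\tau$ associated to $K$, \[\Lambda_n^{\mathbf{x}} = O(n^{2\alpha_\tau}),\] that is, there is a constant $C>0$ depending only on $K$ and $\tau$ such that $\Lambda_n^{\mathbf{x}}\le C\,n^{2\alpha_\tau}$ for all $\mathbf{x}\in\mathcal{L}_\tau$ and all integers $n\ge 1$. Moreover, if $K=[-1,1]$, then $\Lambda_n^{\mathbf{x}}\le C_\tau\, n^{2\alpha_\tau}$ for all $\mathbf{x}\in\mathcal{L}_\tau$ and all integers $n\ge1$, with \[ C_\tau=\tau^{-1}+2^{\alpha_\tau+1}(1+e)^{\alpha_\tau}\bigl(2(1+e)+\tau\bigr)\tau^{-(\alpha_\tau+3)}\left[\frac{2^{\alpha_\tau+1}}{\alpha_\tau}+\frac{\pi^{\alpha_\tau}}{\alpha_\tau-1}\right]\left(\frac{2(1+e)+2\tau}{2(1+e)+\tau}\right)^{\alpha_\tau+1}. \]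
   Context: For a compact set $K$ and $\tau\in(0,1]$, the set of $\tau$-Leja sequences associated to $K$ is \[\mathcal{L}_\tau=\Big\{\mathbf{x}=(x_n)_{n\ge0}\in K^{\mathbb{N}} : \forall n\ge1,\ \prod_{k=0}^{n-1}|x_n-x_k|\ \ge\ \tau\,\sup_{x\in K}\prod_{k=0}^{n-1}|x-x_k|\Big\}.\] For $\mathbf{x}\in\mathcal{L}_\tau$ and $n\ge1$, the Lebesgue constant is \[\Lambda_n^{\mathbf{x}}=\sup_{x\in K}\sum_{k=0}^{n-1}|\ell_{k,n}^{\mathbf{x}}(x)|,\qquad \ell_{k,n}^{\mathbf{x}}(x)=\prod_{\substack{0\le j\le n-1\\ j\ne k}}\frac{x-x_j}{x_k-x_j}.\] Constants: $\lambda$ is the positive solution of $e^{e^{\lambda}}(e^{\lambda}-1)=1$ ($\lambda=0.24565978\ldots$); \[\theta=\sup_{0<a<1,\ B>1}\frac{B\ln(1-a)+\ln(B+a)}{(1+B)\ln(a^{-1})}\] ($\theta=0.08899552\ldots$); and for $\tau\in(0,1]$, \[\alpha_\tau=1+\theta+2\lambda^{-1}\ln(\tau^{-1}).\] *)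

theory Defs
  imports Complex_Main
begin

definition finite_interval_union :: "real set \<Rightarrow> bool" where
  "finite_interval_union K \<longleftrightarrow>
     (\<exists>I :: (real \<times> real) set. finite I \<and> I \<noteq> {} \<and> (\<forall>(a, b)\<in>I. a < b) \<and> K = (\<Union>(a, b)\<in>I. {a..b}))"

text \<open>
  All suprema below are real suprema; for nonempty compact \<open>K\<close> they range over nonempty,
  bounded sets of reals.
\<close>

definition leja_sequences :: "real \<Rightarrow> real set \<Rightarrow> (nat \<Rightarrow> real) set" where
  "leja_sequences \<tau> K =
     {x. (\<forall>n. x n \<in> K) \<and>
         (\<forall>n\<ge>1. (\<Prod>k<n. \<bar>x n - x k\<bar>) \<ge> \<tau> * (SUP y\<in>K. \<Prod>k<n. \<bar>y - x k\<bar>))}"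

definition lagrange_basis :: "(nat \<Rightarrow> real) \<Rightarrow> nat \<Rightarrow> nat \<Rightarrow> real \<Rightarrow> real" where
  "lagrange_basis x n k y = (\<Prod>j\<in>{..<n} - {k}. (y - x j) / (x k - x j))"

definition lebesgue_constant :: "real set \<Rightarrow> (nat \<Rightarrow> real) \<Rightarrow> nat \<Rightarrow> real" where
  "lebesgue_constant K x n = (SUP y\<in>K. \<Sum>k<n. \<bar>lagrange_basis x n k y\<bar>)"

text \<open>
  The left-hand side of the defining equation increases strictly from \<open>0\<close> to \<open>\<infinity>\<close> on the
  nonnegative reals, so the positive solution exists and is unique; it is \<open>0.24565978...\<close>.
\<close>

definition leja_lambda :: real where
  "leja_lambda = (THE l. l > 0 \<and> exp (exp l) * (exp l - 1) = 1)"

text \<open>The set is bounded above; its supremum is \<open>0.08899552...\<close>.\<close>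

definition leja_theta :: real where
  "leja_theta =
     Sup {(B * ln (1 - a) + ln (B + a)) / ((1 + B) * ln (inverse a)) | a B. 0 < a \<and> a < 1 \<and> 1 < B}"

definition leja_alpha :: "real \<Rightarrow> real" where
  "leja_alpha \<tau> = 1 + leja_theta + 2 * inverse leja_lambda * ln (inverse \<tau>)"

definition leja_const :: "real \<Rightarrow> real" where
  "leja_const \<tau> =
     (let \<alpha> = leja_alpha \<tau>; e = exp 1 in
        inverse \<tau> +
        2 powr (\<alpha> + 1) * (1 + e) powr \<alpha> * (2 * (1 + e) + \<tau>) * \<tau> powr (- (\<alpha> + 3)) *
        (2 powr (\<alpha> + 1) / \<alpha> + pi powr \<alpha> / (\<alpha> - 1)) *
        ((2 * (1 + e) + 2 * \<tau>) / (2 * (1 + e) + \<tau>)) powr (\<alpha> + 1))"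

end

theory Submission
  imports Defs "HOL-Complex_Analysis.Complex_Analysis"
begin

text \<open>
  Fix a node \<open>y = x k\<close> and a point \<open>v\<close> of \<open>K\<close>. The \<open>k\<close>-th Lagrange basis polynomial at \<open>v\<close> is a
  product of a part over the earlier nodes, which the Leja condition at \<open>y\<close> bounds by \<open>1 / \<tau>\<close>, and
  of the quotients \<open>\<bar>v - z\<bar> / \<bar>y - z\<bar>\<close> for the later nodes \<open>z\<close>. Such a quotient is large only if \<open>z\<close> is
  much closer to \<open>y\<close> than \<open>v\<close> is. In that case the Leja condition at \<open>z\<close> allows \<open>v\<close> to be replaced by
  \<open>z\<close> in the product over all nodes before \<open>z\<close>, at the price of a factor \<open>1 / \<tau>\<close>. Going back in time,
  \<open>v\<close> is thus replaced by nodes that are closer and closer to \<open>y\<close>.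

  Nodes on the two sides of \<open>y\<close> have to be treated together. The argument follows two points \<open>u < y < v\<close>
  and the weighted geometric mean of the quotients at \<open>u\<close> and at \<open>v\<close>, with the weights that express \<open>y\<close>
  as a convex combination of \<open>u\<close> and \<open>v\<close>. By concavity of the logarithm a node outside \<open>[u, v]\<close> never
  increases this mean. Consider a node between \<open>y\<close> and \<open>v\<close>, and let \<open>r\<close> be the quotient of the
  distances of \<open>v\<close> and of the node from \<open>y\<close>. If \<open>r \<le> exp \<lambda>\<close>, the mean does not increase either; this
  is what the equation for \<open>\<lambda>\<close> expresses. Otherwise the node takes the place of \<open>v\<close>. It multiplies
  the mean by at most \<open>r powr (1 + \<theta>)\<close> if \<open>v\<close> is closer to \<open>y\<close> than \<open>u\<close>, which is how \<open>\<theta>\<close> is defined, and by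
  at most \<open>r\<close> if not; and the factor \<open>1 / \<tau>\<close> is at most \<open>r powr \<kappa>\<close> for \<open>\<kappa> = ln (1 / \<tau>) / \<lambda>\<close>.
  The powers of \<open>r\<close> telescope on both sides of \<open>y\<close>. In the end the mean contains the factors \<open>\<bar>u - y\<bar>\<close> and
  \<open>\<bar>v - y\<bar>\<close>, which make up for one of the two sides, except for the powers \<open>\<kappa>\<close>. So the exponent is
  \<open>\<alpha> = 1 + \<theta> + 2 * \<kappa>\<close>: if no later node is closer to \<open>y\<close> than \<open>d\<close> and \<open>K\<close> has diameter at most \<open>D\<close>,
  then \<open>\<bar>l\<^sub>k\<bar> \<le> 2 / \<tau>\<^sup>2 * (D / d) powr \<alpha>\<close> on \<open>K\<close> (\<open>pair_mean_le\<close>, \<open>Q_le\<close>, \<open>lagrange_basis_bound\<close>).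

  It remains to bound the distances of the nodes from below. On an interval contained in \<open>K\<close>, at each
  node a polynomial of degree less than \<open>n\<close> is at least \<open>\<tau>\<close> times its maximum in absolute value, while it
  vanishes at the earlier nodes. Cauchy estimates for the derivative therefore separate the nodes by
  \<open>\<tau> / (e * n)\<close> in the angular variable \<open>arccos\<close>, and by a multiple of \<open>\<tau> / n\<^sup>2\<close> in distance
  (\<open>node_separation\<close>). Hence a node at angular distance \<open>\<psi> \<ge> 1 / n\<close> from the endpoints has \<open>d\<close> at least
  of order \<open>\<tau> * \<psi> / n\<close>. Since \<open>\<alpha> > 1\<close>, the sum of \<open>d powr (- \<alpha>)\<close> over the nodes is dominated by the few nodes near
  the endpoints; it is at most of order \<open>n powr (2 * \<alpha>)\<close>, the bound for its largest term (\<open>angle_gap_sum\<close>).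
  For a union of intervals, nodes in different components are at a distance bounded below, and the
  at most \<open>n\<close> additional terms that this causes are bounded.
\<close>

section \<open>The constants\<close>

lemma leja_lambda_props:
  shows leja_lambda_pos: "0 < leja_lambda"
    and leja_lambda_eq: "exp (exp leja_lambda) * (exp leja_lambda - 1) = 1"
proof -
  define F :: "real \<Rightarrow> real" where "F = (\<lambda>l. exp (exp l) * (exp l - 1))"
  have mono: "F l < F m" if "0 < l" "l < m" for l m
    unfolding F_def using that by (intro mult_strict_mono) auto
  have "\<exists>l. 0 \<le> l \<and> l \<le> 1 \<and> F l = 1"
  proof (rule IVT)
    show "F 0 \<le> 1" by (simp add: F_def)
    have "exp (1::real) \<ge> 2" using exp_ge_add_one_self[of "1::real"] by simp
    moreover have "exp (exp (1::real)) \<ge> 1" by simp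
    ultimately have "1 * 1 \<le> exp (exp (1::real)) * (exp 1 - 1)" by (intro mult_mono) auto
    then show "1 \<le> F 1" by (simp add: F_def)
  qed (auto simp: F_def)
  then obtain l where l: "0 \<le> l" "F l = 1" by blast
  have "l \<noteq> 0" using l by (auto simp: F_def)
  with l have l0: "0 < l" by simp
  have uniq: "m = l" if "0 < m \<and> F m = 1" for m
    using mono[of m l] mono[of l m] that l l0 by force
  have "leja_lambda = l"
    unfolding leja_lambda_def
  proof (rule the_equality)
    show "0 < l \<and> exp (exp l) * (exp l - 1) = 1" using l(2) l0 unfolding F_def by blast
    show "m = l" if "0 < m \<and> exp (exp m) * (exp m - 1) = 1" for m
      using uniq[unfolded F_def, OF that] .
  qed
  then show "0 < leja_lambda" "exp (exp leja_lambda) * (exp leja_lambda - 1) = 1"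
    using l0 l(2) unfolding F_def by blast+
qed

text \<open>
  For \<open>r > 1\<close> the condition \<open>(r - 1) * exp r \<le> 1\<close> is equivalent to \<open>r \<le> exp \<lambda>\<close>. It says that the slope at
  \<open>B = 0\<close> of \<open>B * ln (r - 1) + ln (1 + r * B)\<close> is not positive, and this function of \<open>B\<close> is the
  logarithmic cost, up to a positive factor, of a node at relative distance \<open>1 / r\<close>.
\<close>

lemma ln_diff_one_le:
  assumes "1 < r" "r \<le> exp leja_lambda"
  shows "ln (r - 1) + r \<le> 0"
proof -
  have "exp r * (r - 1) \<le> exp (exp leja_lambda) * (exp leja_lambda - 1)"
    using assms by (intro mult_mono) auto
  then have "exp (r + ln (r - 1)) \<le> 1"
    using assms leja_lambda_eq by (simp add: exp_add)
  then show ?thesis by simp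
qed

lemma exp_leja_lambda_less_2: "exp leja_lambda < 2"
proof (rule ccontr)
  assume "\<not> ?thesis"
  then have "ln (2 - 1) + (2::real) \<le> 0" by (intro ln_diff_one_le) auto
  then show False by simp
qed

text \<open>
  For \<open>a > 2/3\<close> the numerator is not positive because \<open>ln (1 - a) \<le> -1\<close> and \<open>ln (B + a) \<le> B\<close>; for smaller
  \<open>a\<close> the numerator is at most \<open>B\<close> and \<open>ln (1 / a) \<ge> 1/3\<close>.
\<close>

lemma leja_theta_bdd:
  "bdd_above {(B * ln (1 - a) + ln (B + a)) / ((1 + B) * ln (inverse a)) | a B :: real.
     0 < a \<and> a < 1 \<and> 1 < B}"
proof (rule bdd_aboveI, clarify)
  fix a B :: real
  assume *: "0 < a" "a < 1" "1 < B"
  define L where "L = ln (inverse a)"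
  have L: "L > 0" unfolding L_def using * by (simp add: one_less_inverse)
  have ln_le: "ln (B + a) \<le> B" using ln_le_minus_one[of "B + a"] * by simp
  have "B * ln (1 - a) + ln (B + a) \<le> 3 * ((1 + B) * L)"
  proof (cases "a \<le> 2/3")
    case True
    have "1 - a \<le> L" unfolding L_def using ln_le_minus_one[of a] * by (simp add: ln_inverse)
    then have "1 * B \<le> (3 * L) * (1 + B)" using True * by (intro mult_mono) auto
    moreover have "B * ln (1 - a) \<le> 0" using * by (intro mult_nonneg_nonpos) auto
    ultimately show ?thesis using ln_le by (simp add: algebra_simps)
  next
    case False
    have "exp (1::real) \<le> 3" by (rule exp_le)
    then have "1 / 3 \<le> 1 / exp (1::real)" by (intro divide_left_mono) auto
    then have "1 - a \<le> exp (- 1)" using False unfolding exp_minus inverse_eq_divide by linarith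
    then have "ln (1 - a) \<le> ln (exp (- 1))" using * by (subst ln_le_cancel_iff) auto
    then have "ln (1 - a) \<le> -1" by simp
    then have "B * ln (1 - a) \<le> B * (-1)" using * by (intro mult_left_mono) auto
    moreover have "0 \<le> 3 * ((1 + B) * L)" using L * by auto
    ultimately show ?thesis using ln_le by linarith
  qed
  then show "(B * ln (1 - a) + ln (B + a)) / ((1 + B) * ln (inverse a)) \<le> 3"
    using L * unfolding L_def[symmetric] by (simp add: pos_divide_le_eq)
qed

lemma leja_theta_upper:
  assumes "0 < a" "a < 1" "1 < B"
  shows "B * ln (1 - a) + ln (B + a) \<le> leja_theta * ((1 + B) * ln (inverse a))"
proof -
  have "(B * ln (1 - a) + ln (B + a)) / ((1 + B) * ln (inverse a)) \<le> leja_theta"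
    unfolding leja_theta_def by (rule cSup_upper[OF _ leja_theta_bdd]) (use assms in blast)
  moreover have "0 < (1 + B) * ln (inverse a)"
    using assms by (simp add: one_less_inverse)
  ultimately show ?thesis by (simp add: pos_divide_le_eq)
qed

text \<open>
  Positivity makes the exponent \<open>\<alpha>\<close> larger than 1, which is what the summation over the nodes
  needs. The pair \<open>a = 1/10\<close>, \<open>B = 10\<close> is a witness.
\<close>

lemma leja_theta_pos: "0 < leja_theta"
proof -
  have "0 < ln ((9/10) ^ 10 * (101/10 :: real))" by (simp add: power_divide)
  also have "\<dots> = 10 * ln (1 - 1/10) + ln (10 + 1/10 :: real)"
    by (subst ln_mult) (simp_all add: ln_realpow)
  also have "\<dots> \<le> leja_theta * ((1 + 10) * ln (inverse (1/10)))"
    by (rule leja_theta_upper) auto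
  finally show ?thesis by (simp add: zero_less_mult_iff)
qed

section \<open>The cost of one node\<close>

text \<open>
  The points \<open>u = - p\<close> and \<open>v = q\<close> have \<open>0\<close> as their mean with weights \<open>q / (p + q)\<close> and \<open>p / (p + q)\<close>.
  A node at \<open>a > 0\<close> contributes this factor to the geometric mean, with these weights, of the
  quotients \<open>\<bar>u - a\<bar> / a\<close> and \<open>\<bar>v - a\<bar> / a\<close>.
\<close>

definition node_factor :: "real \<Rightarrow> real \<Rightarrow> real \<Rightarrow> real" where
  "node_factor p q a = \<bar>q - a\<bar> powr (p / (p + q)) * (p + a) powr (q / (p + q)) / a"

text \<open>
  Both \<open>a - q\<close> and \<open>a + p\<close> are nonnegative and their weighted arithmetic mean is \<open>a\<close>.
\<close>

lemma node_factor_outside: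
  assumes "0 < p" "0 < q" "q \<le> a"
  shows "node_factor p q a \<le> 1"
proof (cases "q = a")
  case True
  then show ?thesis by (simp add: node_factor_def)
next
  case False
  have "\<bar>q - a\<bar> powr (p / (p + q)) * (p + a) powr (q / (p + q))
      \<le> p / (p + q) * \<bar>q - a\<bar> + q / (p + q) * (p + a)"
    by (rule Youngs_inequality_0) (use assms False in \<open>auto simp: add_divide_distrib[symmetric]\<close>)
  also have "\<dots> = (p * (a - q) + q * (p + a)) / (p + q)"
    using assms by (simp add: add_divide_distrib)
  also have "p * (a - q) + q * (p + a) = a * (p + q)" by (simp add: algebra_simps)
  also have "a * (p + q) / (p + q) = a" using assms by simp
  finally show ?thesis using assms by (simp add: node_factor_def)
qed

lemma node_factor_inside_le:
  assumes "0 < p" "0 < q" "0 < a" "a < q"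
    and le: "p * ln ((q - a) / a) + q * ln ((p + a) / a) \<le> (p + q) * ln c" and "0 < c"
  shows "node_factor p q a \<le> c"
proof -
  have f: "ln ((q - a) / a) = ln (q - a) - ln a" "ln ((p + a) / a) = ln (p + a) - ln a"
    using assms by (auto intro: ln_divide_pos)
  have "ln (node_factor p q a) = (p * ln ((q - a) / a) + q * ln ((p + a) / a)) / (p + q)"
  proof -
    have "ln (node_factor p q a) = p / (p + q) * ln (q - a) + q / (p + q) * ln (p + a) - ln a"
      using assms unfolding node_factor_def by (simp add: ln_div ln_mult ln_powr)
    also have "ln a = (p + q) * ln a / (p + q)" using assms by simp
    finally show ?thesis
      using assms unfolding f by (simp add: ring_distribs add_divide_distrib diff_divide_distrib)
  qed
  also have "\<dots> \<le> ln c" using assms by (simp add: pos_divide_le_eq mult.commute)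
  finally show ?thesis using assms by (simp add: node_factor_def)
qed

text \<open>
  With \<open>r = q / a\<close>, the logarithm of the factor is at most a positive multiple of
  \<open>ln (r - 1) + r\<close>, because \<open>ln (1 + p / a) \<le> p / a\<close>.
\<close>

lemma node_factor_close:
  assumes "0 < p" "0 < q" "0 < a" "a < q" "q \<le> exp leja_lambda * a"
  shows "node_factor p q a \<le> 1"
proof (rule node_factor_inside_le)
  define r where "r = q / a"
  have r: "1 < r" "r \<le> exp leja_lambda" using assms by (auto simp: r_def field_simps)
  have "ln ((q - a) / a) = ln (r - 1)" using assms by (simp add: r_def diff_divide_distrib)
  moreover have "q * ln ((p + a) / a) \<le> q * (p / a)"
    using ln_le_minus_one[of "(p + a) / a"] assms by (intro mult_left_mono) (auto simp: field_simps)
  moreover have "q * (p / a) = p * r" by (simp add: r_def)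
  moreover have "p * (ln (r - 1) + r) \<le> 0"
    using ln_diff_one_le[OF r] assms by (intro mult_nonneg_nonpos) auto
  ultimately show "p * ln ((q - a) / a) + q * ln ((p + a) / a) \<le> (p + q) * ln 1"
    by (simp add: algebra_simps)
qed (use assms in auto)

text \<open>
  In the scale \<open>q = 1\<close>, with \<open>b = p / q \<le> 1\<close> and \<open>t = a / q\<close>, the bound \<open>ln s \<le> s - 1\<close> gives
  \<open>b * ln (1 - t) + ln (b + t) \<le> - (1 - t) * (1 - b)\<close>.
\<close>

lemma node_factor_far_side:
  assumes "0 < p" "p \<le> q" "0 < a" "a < q"
  shows "node_factor p q a \<le> q / a"
proof (rule node_factor_inside_le)
  define b t where "b = p / q" and "t = a / q"
  have b: "0 < b" "b \<le> 1" and t: "0 < t" "t < 1" using assms by (auto simp: b_def t_def)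
  have "1 - t = (q - a) / q" "b + t = (p + a) / q" using assms by (auto simp: b_def t_def field_simps)
  then have eqs: "ln ((q - a) / a) = ln (1 - t) + ln (q / a)" "ln ((p + a) / a) = ln (b + t) + ln (q / a)"
    using assms by (simp_all add: ln_divide_pos del: diff_divide_eq_iff)
  have "b * ln (1 - t) \<le> b * (- t)"
    using ln_le_minus_one[of "1 - t"] b t by (intro mult_left_mono) auto
  moreover have "ln (b + t) \<le> b + t - 1" using b t by (intro ln_le_minus_one) auto
  moreover have "0 \<le> (1 - t) * (1 - b)" using b t by simp
  ultimately have "b * ln (1 - t) + ln (b + t) \<le> 0" by (simp add: algebra_simps)
  then have "q * (b * ln (1 - t) + ln (b + t)) \<le> 0"
    using assms by (intro mult_nonneg_nonpos) auto
  moreover have "q * b = p" using assms by (simp add: b_def)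
  ultimately have "p * ln (1 - t) + q * ln (b + t) \<le> 0"
    by (simp add: distrib_left mult.assoc[symmetric])
  then show "p * ln ((q - a) / a) + q * ln ((p + a) / a) \<le> (p + q) * ln (q / a)"
    unfolding eqs by (simp add: algebra_simps)
qed (use assms in auto)

text \<open>
  In the scale \<open>q = 1\<close> this is the inequality by which \<open>\<theta>\<close> is defined, for \<open>B = p / q\<close>.
\<close>

lemma node_factor_near_side:
  assumes "0 < q" "q < p" "0 < a" "a < q"
  shows "node_factor p q a \<le> (q / a) powr (1 + leja_theta)"
proof (rule node_factor_inside_le)
  define b t where "b = p / q" and "t = a / q"
  have b: "1 < b" and t: "0 < t" "t < 1" using assms by (auto simp: b_def t_def)
  have it: "inverse t = q / a" by (simp add: t_def)
  have "1 - t = (q - a) / q" "b + t = (p + a) / q" using assms by (auto simp: b_def t_def field_simps)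
  then have eqs: "ln ((q - a) / a) = ln (1 - t) + ln (q / a)" "ln ((p + a) / a) = ln (b + t) + ln (q / a)"
    using assms by (simp_all add: ln_divide_pos del: diff_divide_eq_iff)
  have "q * (b * ln (1 - t) + ln (b + t)) \<le> q * (leja_theta * ((1 + b) * ln (q / a)))"
    using leja_theta_upper[OF t b] assms it by (intro mult_left_mono) auto
  moreover have qb: "q * b = p" using assms by (simp add: b_def)
  moreover have "q * (leja_theta * ((1 + b) * ln (q / a))) = leja_theta * ((q + q * b) * ln (q / a))"
    by (simp add: algebra_simps)
  ultimately have "p * ln (1 - t) + q * ln (b + t) \<le> leja_theta * ((q + p) * ln (q / a))"
    by (simp add: algebra_simps flip: qb)
  then show "p * ln ((q - a) / a) + q * ln ((p + a) / a)
      \<le> (p + q) * ln ((q / a) powr (1 + leja_theta))"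
    unfolding eqs using assms by (simp add: algebra_simps ln_powr)
qed (use assms in auto)

section \<open>The product over the later nodes\<close>

lemma weight_complement:
  fixes p q :: real
  assumes "0 < p" "0 < q"
  shows "p / (p + q) = 1 - q / (p + q)"
proof -
  have "p / (p + q) + q / (p + q) = 1"
    using assms by (simp add: add_divide_distrib[symmetric])
  then show ?thesis by linarith
qed

lemma weight_antimono:
  fixes p a q :: real
  assumes "0 < p" "0 < a" "a \<le> q"
  shows "p / (p + q) \<le> p / (p + a)"
  using assms by (intro divide_left_mono mult_pos_pos add_pos_pos) linarith+

text \<open>
  The node under consideration is moved to \<open>0\<close>, and \<open>z 0, \<dots>, z (N - 1)\<close> are the nodes chosen after
  it. The function \<open>g\<close> is the quotient of the product over the nodes chosen before it by the value of
  that product at \<open>0\<close>. The bound on \<open>g\<close> and the assumption \<open>leja\<close> are the Leja conditions at \<open>0\<close> and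
  at \<open>z i\<close>, divided by a common factor.
\<close>

locale later_nodes =
  fixes K :: "real set" and g :: "real \<Rightarrow> real" and z :: "nat \<Rightarrow> real"
    and N :: nat and \<tau> d D :: real
  assumes tau: "0 < \<tau>" "\<tau> \<le> 1"
    and d: "0 < d" "d \<le> D"
    and diam: "s \<in> K \<Longrightarrow> t \<in> K \<Longrightarrow> \<bar>s - t\<bar> \<le> D"
    and zero: "0 \<in> K"
    and g_nonneg: "0 \<le> g t"
    and g_le: "t \<in> K \<Longrightarrow> g t \<le> 1 / \<tau>"
    and z_in: "i < N \<Longrightarrow> z i \<in> K"
    and z_far: "i < N \<Longrightarrow> d \<le> \<bar>z i\<bar>"
    and leja: "i < N \<Longrightarrow> t \<in> K \<Longrightarrow>
      \<tau> * (g t * \<bar>t\<bar> * (\<Prod>l<i. \<bar>t - z l\<bar> / \<bar>z l\<bar>))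
        \<le> g (z i) * \<bar>z i\<bar> * (\<Prod>l<i. \<bar>z i - z l\<bar> / \<bar>z l\<bar>)"
begin

text \<open>
  Up to normalization this is the absolute value of the polynomial whose zeros are \<open>0\<close>, the earlier
  nodes and the first \<open>i\<close> later nodes; the normalization is that the derivative at \<open>0\<close> has absolute
  value \<open>g 0\<close>.
\<close>

definition Q :: "nat \<Rightarrow> real \<Rightarrow> real" where
  "Q i t = g t * \<bar>t\<bar> * (\<Prod>l<i. \<bar>t - z l\<bar> / \<bar>z l\<bar>)"

definition \<kappa> :: real where
  "\<kappa> = inverse leja_lambda * ln (inverse \<tau>)"

text \<open>
  Distances below \<open>d\<close> count as \<open>d\<close>: a point at such a distance from \<open>0\<close> is never replaced by a node.
\<close>

definition rel_dist :: "real \<Rightarrow> real" where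
  "rel_dist p = max p d / d"

definition pair_mean :: "nat \<Rightarrow> real \<Rightarrow> real \<Rightarrow> real" where
  "pair_mean i u v =
     Q i u powr (\<bar>v\<bar> / (\<bar>u\<bar> + \<bar>v\<bar>)) * Q i v powr (\<bar>u\<bar> / (\<bar>u\<bar> + \<bar>v\<bar>))"

text \<open>
  Up to a constant, a bound for the mean at a pair with distances \<open>p\<close> and \<open>q\<close> from \<open>0\<close>. A replacement
  that decreases one distance by the ratio \<open>r\<close> costs \<open>r\<close> and \<open>r powr \<kappa>\<close> on either side, and \<open>r powr \<theta>\<close>
  in addition only on the near side, whence the minimum. The product \<open>p * q\<close> is divided by \<open>d\<close> only
  once, because the mean with which the process ends is not of order 1 but of the order of the smaller
  distance.
\<close>

definition pair_bound :: "real \<Rightarrow> real \<Rightarrow> real" where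
  "pair_bound p q = p * q / d * (rel_dist p * rel_dist q) powr \<kappa> * min (rel_dist p) (rel_dist q) powr leja_theta"

lemma Q_nonneg: "0 \<le> Q i t"
  unfolding Q_def by (intro mult_nonneg_nonneg prod_nonneg) (auto simp: g_nonneg)

lemma Q_0_le: "t \<in> K \<Longrightarrow> Q 0 t \<le> 1 / \<tau> * \<bar>t\<bar>"
  unfolding Q_def using g_le[of t] by (simp only: prod.empty lessThan_0 mult_1_right) (rule mult_right_mono, auto)

lemma Q_Suc: "Q (Suc i) t = Q i t * (\<bar>t - z i\<bar> / \<bar>z i\<bar>)"
  by (simp add: Q_def)

lemma leja_Q: "i < N \<Longrightarrow> t \<in> K \<Longrightarrow> Q i t \<le> Q i (z i) / \<tau>"
  using leja[of i t] tau by (simp add: Q_def pos_le_divide_eq mult.commute)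

lemma kappa_nonneg: "0 \<le> \<kappa>"
  using leja_lambda_pos tau by (simp add: \<kappa>_def one_le_inverse)

lemma rel_dist_ge_1: "1 \<le> rel_dist p"
  using d by (simp add: rel_dist_def)

lemma rel_dist_mono: "p \<le> q \<Longrightarrow> rel_dist p \<le> rel_dist q"
  using d by (simp add: rel_dist_def divide_right_mono)

lemma rel_dist_ratio: "d \<le> a \<Longrightarrow> a \<le> q \<Longrightarrow> rel_dist q = q / a * rel_dist a"
  using d by (simp add: rel_dist_def)

lemma pair_bound_sym: "pair_bound p q = pair_bound q p"
  by (simp add: pair_bound_def mult.commute min.commute)

lemma pair_mean_sym: "pair_mean i u v = pair_mean i v u"
  by (simp add: pair_mean_def mult.commute add.commute)

text \<open>
  A loss of \<open>1 / \<tau>\<close> is charged to a decrease of the distance by a factor of at least \<open>exp \<lambda>\<close>.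
\<close>

lemma inv_tau_le_powr:
  assumes "exp leja_lambda \<le> r"
  shows "1 / \<tau> \<le> r powr \<kappa>"
proof -
  have r: "0 < r" using assms by (meson exp_gt_zero less_le_trans)
  have "ln (1 / \<tau>) = \<kappa> * leja_lambda"
    using leja_lambda_pos by (simp add: \<kappa>_def inverse_eq_divide)
  also have "\<dots> \<le> \<kappa> * ln r"
    using assms kappa_nonneg r by (intro mult_left_mono) (auto simp: ln_ge_iff)
  finally have "exp (ln (1 / \<tau>)) \<le> exp (\<kappa> * ln r)" by simp
  then show ?thesis using tau r by (simp add: powr_def)
qed

lemma pair_mean_Suc:
  assumes "u \<noteq> 0" "u * v < 0" "0 < z i * v"
  shows "pair_mean (Suc i) u v = pair_mean i u v * node_factor \<bar>u\<bar> \<bar>v\<bar> \<bar>z i\<bar>"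
proof -
  let ?p = "\<bar>u\<bar>" and ?q = "\<bar>v\<bar>" and ?a = "\<bar>z i\<bar>"
  have abs: "\<bar>u - z i\<bar> = ?p + ?a" "\<bar>v - z i\<bar> = \<bar>?q - ?a\<bar>"
    using assms by (auto simp: mult_less_0_iff zero_less_mult_iff)
  have a: "0 < ?a" using assms by auto
  have pq: "0 < ?p + ?q" using assms by linarith
  define s t where "s = ?q / (?p + ?q)" and "t = ?p / (?p + ?q)"
  have "s + t = 1" using pq by (simp add: s_def t_def add_divide_distrib[symmetric] add.commute)
  then have powr_a: "?a powr s * ?a powr t = ?a"
    using powr_add[of ?a s t] a by (metis abs_ge_zero powr_one)
  have "pair_mean (Suc i) u v =
      Q i u powr s * ((?p + ?a) powr s / ?a powr s) * (Q i v powr t * (\<bar>?q - ?a\<bar> powr t / ?a powr t))"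
    unfolding pair_mean_def Q_Suc abs s_def[symmetric] t_def[symmetric]
    using a Q_nonneg by (simp add: powr_mult powr_divide)
  also have "\<dots> = Q i u powr s * Q i v powr t * (\<bar>?q - ?a\<bar> powr t * (?p + ?a) powr s / (?a powr s * ?a powr t))"
    by simp
  finally show ?thesis
    unfolding powr_a by (simp add: pair_mean_def node_factor_def s_def t_def)
qed

text \<open>
  When \<open>v\<close> is replaced by \<open>z i\<close>, which is closer to \<open>0\<close>, the weight of \<open>u\<close> decreases. The excess weight
  is moved to \<open>z i\<close> as well, since the Leja condition bounds \<open>Q i u\<close> and \<open>Q i v\<close> alike. The total weight
  moved is at most 1, so only one factor \<open>1 / \<tau>\<close> is lost.
\<close>

lemma pair_mean_switch:
  assumes i: "i < N" and K: "u \<in> K" "v \<in> K" and opp: "u * v < 0"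
    and side: "0 < z i * v" and less: "\<bar>z i\<bar> < \<bar>v\<bar>"
  shows "pair_mean i u v \<le> pair_mean i u (z i) / \<tau>"
proof -
  let ?p = "\<bar>u\<bar>" and ?q = "\<bar>v\<bar>" and ?a = "\<bar>z i\<bar>"
  have pos: "0 < ?p" "0 < ?q" "0 < ?a" using opp side by auto
  define s where "s = ?q / (?p + ?q)"
  define s' where "s' = ?a / (?p + ?a)"
  have co: "?p / (?p + ?q) = 1 - s" "?p / (?p + ?a) = 1 - s'"
    unfolding s_def s'_def using pos by (auto intro: weight_complement)
  have "?p / (?p + ?q) \<le> ?p / (?p + ?a)"
    using pos less by (intro weight_antimono) linarith+
  then have s: "0 < s'" "s' \<le> s" "s \<le> 1"
    using pos unfolding co by (simp_all add: s_def s'_def)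
  have "pair_mean i u v = Q i u powr s * Q i v powr (1 - s)"
    by (simp add: pair_mean_def co flip: s_def)
  also have "Q i u powr s = Q i u powr s' * Q i u powr (s - s')"
    using powr_add[of "Q i u" s' "s - s'"] by simp
  also have "Q i u powr s' * Q i u powr (s - s') * Q i v powr (1 - s)
      \<le> Q i u powr s' * (Q i (z i) / \<tau>) powr (s - s') * (Q i (z i) / \<tau>) powr (1 - s)"
    using s leja_Q[OF i] K Q_nonneg
    by (intro mult_mono mult_left_mono powr_mono2 mult_nonneg_nonneg) auto
  also have "\<dots> = Q i u powr s' * (Q i (z i) / \<tau>) powr (1 - s')"
    using powr_add[of "Q i (z i) / \<tau>" "s - s'" "1 - s"] by (simp add: mult.assoc)
  also have "\<dots> = Q i u powr s' * Q i (z i) powr (1 - s') * (1 / \<tau>) powr (1 - s')"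
    using tau Q_nonneg by (simp add: powr_divide)
  also have "\<dots> \<le> Q i u powr s' * Q i (z i) powr (1 - s') * (1 / \<tau>) powr 1"
    using s tau by (intro mult_left_mono powr_mono mult_nonneg_nonneg) auto
  also have "\<dots> = pair_mean i u (z i) / \<tau>"
    using tau by (simp add: pair_mean_def co flip: s'_def)
  finally show ?thesis .
qed

text \<open>
  One replacement: the cost of the node \<open>a\<close> together with the loss of \<open>1 / \<tau>\<close> is covered by the
  decrease of the bound when \<open>q\<close> becomes \<open>a\<close>.
\<close>

lemma pair_bound_switch:
  assumes "0 < p" "d \<le> a" and less: "exp leja_lambda * a \<le> q"
  shows "node_factor p q a * (pair_bound p a / \<tau>) \<le> pair_bound p q"
proof -
  have a: "0 < a" "a < q" using assms d leja_lambda_pos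
    by (auto intro: less_le_trans[OF _ less])
  define r where "r = q / a"
  have r: "1 < r" "exp leja_lambda \<le> r" using a less by (auto simp: r_def field_simps)
  have upq: "rel_dist q = r * rel_dist a" using rel_dist_ratio[of a q] a assms by (simp add: r_def)
  have th: "node_factor p q a * min (rel_dist p) (rel_dist a) powr leja_theta
      \<le> r * min (rel_dist p) (rel_dist q) powr leja_theta"
  proof (cases "q < p")
    case True
    have "rel_dist a \<le> rel_dist q" "rel_dist q \<le> rel_dist p" using True a by (auto intro: rel_dist_mono)
    then have m: "min (rel_dist p) (rel_dist a) = rel_dist a" "min (rel_dist p) (rel_dist q) = rel_dist q" by auto
    have "node_factor p q a * rel_dist a powr leja_theta \<le> r powr (1 + leja_theta) * rel_dist a powr leja_theta"
      using node_factor_near_side[of q p a] True a by (intro mult_right_mono) (auto simp: r_def)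
    also have "\<dots> = r * rel_dist q powr leja_theta"
      using r rel_dist_ge_1[of a] by (simp add: powr_add upq powr_mult)
    finally show ?thesis by (simp add: m)
  next
    case False
    have "rel_dist a \<le> rel_dist q" using a by (intro rel_dist_mono) auto
    then have "min (rel_dist p) (rel_dist a) \<le> min (rel_dist p) (rel_dist q)" by (intro min.mono) auto
    moreover have "0 \<le> min (rel_dist p) (rel_dist a)" using rel_dist_ge_1[of p] rel_dist_ge_1[of a] by simp
    ultimately have "min (rel_dist p) (rel_dist a) powr leja_theta \<le> min (rel_dist p) (rel_dist q) powr leja_theta"
      using leja_theta_pos by (intro powr_mono2) simp_all
    moreover have "node_factor p q a \<le> r"
      using node_factor_far_side[of p q a] False a assms by (simp add: r_def)
    ultimately show ?thesis using r by (intro mult_mono) simp_all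
  qed
  have "node_factor p q a * (pair_bound p a / \<tau>)
      = p * a / d * (rel_dist p * rel_dist a) powr \<kappa> * (1 / \<tau>) * (node_factor p q a * min (rel_dist p) (rel_dist a) powr leja_theta)"
    by (simp add: pair_bound_def)
  also have "\<dots> \<le> p * a / d * (rel_dist p * rel_dist a) powr \<kappa> * r powr \<kappa> * (r * min (rel_dist p) (rel_dist q) powr leja_theta)"
  proof (rule mult_mono[OF _ th])
    show "p * a / d * (rel_dist p * rel_dist a) powr \<kappa> * (1 / \<tau>) \<le> p * a / d * (rel_dist p * rel_dist a) powr \<kappa> * r powr \<kappa>"
      using inv_tau_le_powr[OF r(2)] assms a d by (intro mult_left_mono) auto
    have "0 \<le> node_factor p q a" using assms a by (simp add: node_factor_def)
    then show "0 \<le> node_factor p q a * min (rel_dist p) (rel_dist a) powr leja_theta" by simp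
  qed (use assms a d in auto)
  also have "\<dots> = pair_bound p q"
  proof -
    have "(rel_dist p * rel_dist a) powr \<kappa> * r powr \<kappa> = (rel_dist p * rel_dist q) powr \<kappa>"
      using r rel_dist_ge_1[of p] rel_dist_ge_1[of a] by (simp add: upq powr_mult)
    moreover have "p * a / d * X * Y * (r * Z) = p * (a * r) / d * (X * Y) * Z" for X Y Z by simp
    moreover have "a * r = q" using a by (simp add: r_def)
    ultimately show ?thesis unfolding pair_bound_def by (simp only:)
  qed
  finally show ?thesis .
qed

text \<open>
  The weighted geometric mean of \<open>p\<close> and \<open>q\<close> with weights \<open>q / (p + q)\<close> and \<open>p / (p + q)\<close> is at most
  \<open>2 * p * q / (p + q)\<close>, hence at most twice the smaller distance.
\<close>

lemma pair_mean_0: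
  assumes "u \<in> K" "v \<in> K" "u * v < 0" "d \<le> max \<bar>u\<bar> \<bar>v\<bar>"
  shows "pair_mean 0 u v \<le> 2 / \<tau> * pair_bound \<bar>u\<bar> \<bar>v\<bar>"
proof -
  let ?p = "\<bar>u\<bar>" and ?q = "\<bar>v\<bar>"
  have pos: "0 < ?p" "0 < ?q" using assms by auto
  define s where "s = ?q / (?p + ?q)"
  have s: "0 < s" "s < 1" using pos by (auto simp: s_def field_simps)
  have co: "?p / (?p + ?q) = 1 - s" using pos unfolding s_def by (intro weight_complement)
  have "pair_mean 0 u v \<le> (1 / \<tau> * ?p) powr s * (1 / \<tau> * ?q) powr (1 - s)"
    unfolding pair_mean_def co s_def[symmetric] using s Q_0_le Q_nonneg assms
    by (intro mult_mono powr_mono2) auto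
  also have "\<dots> = (1 / \<tau>) powr s * (1 / \<tau>) powr (1 - s) * (?p powr s * ?q powr (1 - s))"
    using pos tau by (simp add: powr_mult powr_divide)
  also have "(1 / \<tau>) powr s * (1 / \<tau>) powr (1 - s) = 1 / \<tau>"
    using tau by (simp flip: powr_add)
  also have "?p powr s * ?q powr (1 - s) = ?p * ?q * ((1 / ?q) powr s * (1 / ?p) powr (1 - s))"
    using pos by (simp add: powr_divide powr_diff)
  finally have "pair_mean 0 u v \<le>
      1 / \<tau> * (?p * ?q * ((1 / ?q) powr s * (1 / ?p) powr (1 - s)))" .
  also have "\<dots> \<le> 1 / \<tau> * (?p * ?q * (1 / (?p + ?q) + 1 / (?p + ?q)))"
  proof (intro mult_left_mono)
    have "(1 / ?q) powr s * (1 / ?p) powr (1 - s) \<le> s * (1 / ?q) + (1 - s) * (1 / ?p)"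
      using pos s by (intro Youngs_inequality_0) auto
    also have "s * (1 / ?q) = 1 / (?p + ?q)" using pos by (simp add: s_def)
    also have "(1 - s) * (1 / ?p) = 1 / (?p + ?q)" using pos by (simp flip: co)
    finally show "(1 / ?q) powr s * (1 / ?p) powr (1 - s) \<le> 1 / (?p + ?q) + 1 / (?p + ?q)" .
  qed (use tau in auto)
  also have "\<dots> \<le> 1 / \<tau> * (?p * ?q * (2 / d))"
  proof (intro mult_left_mono)
    have "2 / (?p + ?q) \<le> 2 / d" using assms pos d by (intro divide_left_mono) auto
    then show "1 / (?p + ?q) + 1 / (?p + ?q) \<le> 2 / d" by simp
  qed (use pos tau in auto)
  also have "\<dots> = 2 / \<tau> * (?p * ?q / d * 1 * 1)" by simp
  also have "\<dots> \<le> 2 / \<tau> * pair_bound ?p ?q"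
  proof -
    have 1: "1 \<le> rel_dist ?p * rel_dist ?q" using mult_mono[OF rel_dist_ge_1 rel_dist_ge_1] rel_dist_ge_1[of ?p] by fastforce
    have "1 \<le> (rel_dist ?p * rel_dist ?q) powr \<kappa>"
      using 1 kappa_nonneg by (rule ge_one_powr_ge_zero)
    moreover have "1 \<le> min (rel_dist ?p) (rel_dist ?q) powr leja_theta"
      using rel_dist_ge_1 leja_theta_pos by (intro ge_one_powr_ge_zero) auto
    ultimately have "1 * 1 \<le> (rel_dist ?p * rel_dist ?q) powr \<kappa> * min (rel_dist ?p) (rel_dist ?q) powr leja_theta"
      by (rule mult_mono) simp_all
    then have "?p * ?q / d * (1 * 1) \<le>
        ?p * ?q / d * ((rel_dist ?p * rel_dist ?q) powr \<kappa> * min (rel_dist ?p) (rel_dist ?q) powr leja_theta)"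
      using d by (intro mult_left_mono) simp_all
    then have "?p * ?q / d * 1 * 1 \<le> pair_bound ?p ?q" by (simp only: pair_bound_def mult.assoc)
    then show ?thesis by (rule mult_left_mono) (use tau in simp)
  qed
  finally show ?thesis .
qed

text \<open>
  Passing from \<open>i\<close> to \<open>Suc i\<close> multiplies the mean by the cost of the node \<open>z i\<close>. If \<open>z i\<close> is
  closer to \<open>0\<close> by the factor \<open>exp \<lambda>\<close> than the point of the pair on its side, it replaces that point, and
  the induction hypothesis is applied to the new pair; otherwise the cost is at most 1.
\<close>

lemma pair_mean_le:
  assumes "i \<le> N" "u \<in> K" "v \<in> K" "u * v < 0" "d \<le> max \<bar>u\<bar> \<bar>v\<bar>"
  shows "pair_mean i u v \<le> 2 / \<tau> * pair_bound \<bar>u\<bar> \<bar>v\<bar>"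
  using assms
proof (induction i arbitrary: u v)
  case 0
  then show ?case by (intro pair_mean_0) auto
next
  case (Suc i)
  have i: "i < N" using Suc.prems by simp
  have same_side: "pair_mean (Suc i) u v \<le> 2 / \<tau> * pair_bound \<bar>u\<bar> \<bar>v\<bar>"
    if K: "u \<in> K" "v \<in> K" and opp: "u * v < 0" and dmax: "d \<le> max \<bar>u\<bar> \<bar>v\<bar>"
      and side: "0 < z i * v" for u v
  proof -
    let ?p = "\<bar>u\<bar>" and ?q = "\<bar>v\<bar>" and ?a = "\<bar>z i\<bar>"
    have pos: "0 < ?p" "0 < ?q" "0 < ?a" using opp side by auto
    have step: "pair_mean (Suc i) u v = pair_mean i u v * node_factor ?p ?q ?a"
      using opp side by (intro pair_mean_Suc) auto
    have IH: "pair_mean i u v \<le> 2 / \<tau> * pair_bound ?p ?q"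
      using i K opp dmax by (intro Suc.IH) auto
    have mean_nonneg: "0 \<le> pair_mean i u v" by (simp add: pair_mean_def)
    have nf: "0 \<le> node_factor ?p ?q ?a" by (simp add: node_factor_def)
    show ?thesis
    proof (cases "exp leja_lambda * ?a \<le> ?q")
      case False
      then have "node_factor ?p ?q ?a \<le> 1"
        using node_factor_close[of ?p ?q ?a] node_factor_outside[of ?p ?q ?a] pos by linarith
      then show ?thesis unfolding step using IH mean_nonneg
        by (metis mult.commute mult_left_le_one_le nf order_trans)
    next
      case True
      have "1 < exp leja_lambda" using leja_lambda_pos by simp
      then have "1 * ?a < exp leja_lambda * ?a" using pos by (intro mult_strict_right_mono) auto
      then have "?a < ?q" using True by linarith
      have op': "u * z i < 0" using opp side by (auto simp: mult_less_0_iff zero_less_mult_iff)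
      have "pair_mean i u v \<le> pair_mean i u (z i) / \<tau>"
        using i K opp side \<open>?a < ?q\<close> by (rule pair_mean_switch)
      also have "\<dots> \<le> 2 / \<tau> * pair_bound ?p ?a / \<tau>"
        using i K op' z_in[OF i] z_far[OF i] tau
        by (intro divide_right_mono Suc.IH) auto
      finally have "pair_mean (Suc i) u v \<le> 2 / \<tau> * pair_bound ?p ?a / \<tau> * node_factor ?p ?q ?a"
        unfolding step using nf by (rule mult_right_mono)
      also have "\<dots> = 2 / \<tau> * (node_factor ?p ?q ?a * (pair_bound ?p ?a / \<tau>))" by simp
      also have "\<dots> \<le> 2 / \<tau> * pair_bound ?p ?q"
        using pair_bound_switch[OF pos(1) z_far[OF i] True] tau by (intro mult_left_mono) simp_all
      finally show ?thesis .
    qed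
  qed
  have "z i \<noteq> 0" using z_far[OF i] d by auto
  then have "0 < z i * v \<or> 0 < z i * u"
    using Suc.prems by (auto simp: mult_less_0_iff zero_less_mult_iff)
  then show ?case
  proof
    assume "0 < z i * v"
    then show ?case using Suc.prems by (intro same_side) auto
  next
    assume "0 < z i * u"
    then have "pair_mean (Suc i) v u \<le> 2 / \<tau> * pair_bound \<bar>v\<bar> \<bar>u\<bar>"
      using Suc.prems by (intro same_side) (auto simp: mult.commute max.commute)
    then show ?case by (simp add: pair_mean_sym pair_bound_sym)
  qed
qed

text \<open>
  For a single point \<open>v\<close>, only nodes on the other side of \<open>0\<close> and nodes closer than \<open>\<bar>v\<bar> / 2\<close> on the
  same side increase the product. A node of the second kind replaces \<open>v\<close>, at a ratio larger than
  \<open>2 > exp \<lambda>\<close>. The first node of the other kind that is met going back in time forms a pair with \<open>v\<close>.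
\<close>

lemma Q_le:
  assumes "i \<le> N" "v \<in> K"
  shows "Q i v \<le> 2 / \<tau>\<^sup>2 * \<bar>v\<bar> * (D / d) powr (1 + leja_theta + \<kappa>) * rel_dist \<bar>v\<bar> powr \<kappa>"
  using assms
proof (induction i arbitrary: v)
  case 0
  let ?E = "1 + leja_theta + \<kappa>"
  have "Q 0 v \<le> 1 / \<tau> * \<bar>v\<bar> * 1 * 1"
    using Q_0_le[OF 0(2)] by simp
  also have "\<dots> \<le> 2 / \<tau>\<^sup>2 * \<bar>v\<bar> * (D / d) powr ?E * rel_dist \<bar>v\<bar> powr \<kappa>"
  proof (intro mult_mono)
    have "\<tau> * \<tau> \<le> 2 * \<tau>" using tau by (intro mult_right_mono) auto
    then show "1 / \<tau> \<le> 2 / \<tau>\<^sup>2" using tau by (simp add: field_simps power2_eq_square)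
    show "1 \<le> (D / d) powr ?E"
      using d leja_theta_pos kappa_nonneg by (intro ge_one_powr_ge_zero) auto
    show "1 \<le> rel_dist \<bar>v\<bar> powr \<kappa>" by (intro ge_one_powr_ge_zero rel_dist_ge_1 kappa_nonneg)
  qed (use tau in auto)
  finally show ?case .
next
  case (Suc i)
  let ?E = "1 + leja_theta + \<kappa>" and ?q = "\<bar>v\<bar>" and ?a = "\<bar>z i\<bar>"
  \<comment> \<open>The part of the bound that does not depend on the point.\<close>
  define C where "C = 2 / \<tau>\<^sup>2 * (D / d) powr ?E"
  have C: "0 \<le> C" using tau by (simp add: C_def)
  have i: "i < N" using Suc.prems by simp
  have a: "d \<le> ?a" "0 < ?a" using z_far[OF i] d by auto
  have IH: "Q i t \<le> C * \<bar>t\<bar> * rel_dist \<bar>t\<bar> powr \<kappa>" if "t \<in> K" for t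
    using Suc.IH[of t] i that by (simp add: C_def mult_ac)
  have goal: "Q (Suc i) v \<le> C * ?q * rel_dist ?q powr \<kappa>"
  proof -
    consider "v = 0" | "z i * v < 0" | "0 < z i * v" "?q \<le> 2 * ?a" | "0 < z i * v" "2 * ?a < ?q"
      using a by (metis abs_0 less_irrefl linorder_neqE_linordered_idom mult_eq_0_iff not_le)
    then show ?thesis
    proof cases
      case 1
      then show ?thesis by (simp add: Q_def)
    next
      case 2
      let ?u = "z i"
      have "0 < ?q" using 2 by auto
      have abs: "\<bar>v - z i\<bar> = ?a + ?q" using 2 by (auto simp: mult_less_0_iff)
      define s where "s = ?q / (?a + ?q)"
      have s: "0 < s" "s \<le> 1" using a \<open>0 < ?q\<close> by (auto simp: s_def field_simps)
      have co: "?a / (?a + ?q) = 1 - s"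
        using a \<open>0 < ?q\<close> unfolding s_def by (intro weight_complement)
      have "Q i v = Q i v powr s * Q i v powr (1 - s)"
        using Q_nonneg[of i v] by (simp flip: powr_add)
      also have "\<dots> \<le> (Q i ?u / \<tau>) powr s * Q i v powr (1 - s)"
        using s leja_Q[OF i] Suc.prems Q_nonneg by (intro mult_right_mono powr_mono2) auto
      also have "\<dots> = (1 / \<tau>) powr s * (Q i ?u powr s * Q i v powr (1 - s))"
        using tau Q_nonneg by (simp add: powr_divide)
      also have "\<dots> \<le> (1 / \<tau>) powr 1 * (Q i ?u powr s * Q i v powr (1 - s))"
        using s tau by (intro mult_right_mono powr_mono) auto
      also have "\<dots> = 1 / \<tau> * pair_mean i ?u v"
        using tau by (simp add: pair_mean_def co flip: s_def)
      also have "\<dots> \<le> 1 / \<tau> * (2 / \<tau> * pair_bound ?a ?q)"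
        using i Suc.prems z_in[OF i] 2 a tau by (intro mult_left_mono pair_mean_le) auto
      finally have "Q (Suc i) v \<le> 1 / \<tau> * (2 / \<tau> * pair_bound ?a ?q) * ((?a + ?q) / ?a)"
        unfolding Q_Suc abs using a by (intro mult_right_mono) auto
      also have "\<dots> = 2 / \<tau>\<^sup>2 * ?q * rel_dist ?q powr \<kappa> *
          ((?a + ?q) / d * rel_dist ?a powr \<kappa> * min (rel_dist ?a) (rel_dist ?q) powr leja_theta)"
        using a d rel_dist_ge_1[of ?a] rel_dist_ge_1[of ?q]
        by (simp add: pair_bound_def powr_mult power2_eq_square mult_ac)
      also have "\<dots> \<le> 2 / \<tau>\<^sup>2 * ?q * rel_dist ?q powr \<kappa> *
          (D / d * (D / d) powr \<kappa> * (D / d) powr leja_theta)"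
      proof (intro mult_left_mono mult_mono powr_mono2)
        show "(?a + ?q) / d \<le> D / d"
          using diam[OF Suc.prems(2) z_in[OF i]] abs d by (simp add: divide_right_mono)
        have "?a \<le> D" using diam[OF z_in[OF i] zero] by simp
        then show "rel_dist ?a \<le> D / d" using d by (simp add: rel_dist_def divide_right_mono)
        then show "min (rel_dist ?a) (rel_dist ?q) \<le> D / d" by simp
        show "0 \<le> rel_dist ?a" "0 \<le> min (rel_dist ?a) (rel_dist ?q)" using rel_dist_ge_1[of ?a] rel_dist_ge_1[of ?q] by auto
      qed (use d tau kappa_nonneg leja_theta_pos in auto)
      also have "\<dots> = C * ?q * rel_dist ?q powr \<kappa>"
        using d by (simp add: C_def powr_add)
      finally show ?thesis .
    next
      case 3
      have "\<bar>v - z i\<bar> \<le> ?a" using 3 by (auto simp: zero_less_mult_iff)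
      then have "Q (Suc i) v \<le> Q i v * 1"
        unfolding Q_Suc using a Q_nonneg by (intro mult_left_mono) auto
      then show ?thesis using IH[OF Suc.prems(2)] by simp
    next
      case 4
      define r where "r = ?q / ?a"
      have r: "exp leja_lambda \<le> r" "0 < r"
      proof -
        have "exp leja_lambda * ?a \<le> 2 * ?a"
          using a exp_leja_lambda_less_2 by (intro mult_right_mono) auto
        then have "exp leja_lambda * ?a \<le> ?q" using 4(2) by linarith
        then show "exp leja_lambda \<le> r" by (simp only: r_def pos_le_divide_eq[OF a(2)])
        show "0 < r" using 4 a by (simp add: r_def)
      qed
      have "\<bar>v - z i\<bar> \<le> ?q" using 4 by (auto simp: zero_less_mult_iff)
      then have "Q (Suc i) v \<le> Q i (z i) / \<tau> * r"
        unfolding Q_Suc r_def using a tau Q_nonneg leja_Q[OF i Suc.prems(2)]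
        by (intro mult_mono divide_right_mono) auto
      also have "\<dots> \<le> C * ?a * rel_dist ?a powr \<kappa> * r powr \<kappa> * r"
        using IH[OF z_in[OF i]] inv_tau_le_powr[OF r(1)] tau r Q_nonneg C
          mult_mono[of "Q i (z i)" "C * ?a * rel_dist ?a powr \<kappa>" "1 / \<tau>" "r powr \<kappa>"]
        by (intro mult_right_mono) auto
      also have "\<dots> = C * (?a * r) * (r * rel_dist ?a) powr \<kappa>"
        using r rel_dist_ge_1[of ?a] by (simp add: powr_mult)
      also have "\<dots> = C * ?q * rel_dist ?q powr \<kappa>"
        using rel_dist_ratio[of ?a ?q] a 4 by (simp add: r_def)
      finally show ?thesis .
    qed
  qed
  then show ?case by (simp add: C_def mult_ac)
qed

lemma basis_le:
  assumes "v \<in> K" "v \<noteq> 0"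
  shows "g v * (\<Prod>l<N. \<bar>v - z l\<bar> / \<bar>z l\<bar>) \<le> 2 / \<tau>\<^sup>2 * (D / d) powr leja_alpha \<tau>"
proof -
  have "\<bar>v\<bar> \<le> D" using diam[OF assms(1) zero] by simp
  then have "rel_dist \<bar>v\<bar> \<le> D / d" using d by (simp add: rel_dist_def divide_right_mono)
  then have "rel_dist \<bar>v\<bar> powr \<kappa> \<le> (D / d) powr \<kappa>"
    using kappa_nonneg rel_dist_ge_1[of "\<bar>v\<bar>"] by (intro powr_mono2) auto
  then have "Q N v \<le> 2 / \<tau>\<^sup>2 * \<bar>v\<bar> * (D / d) powr (1 + leja_theta + \<kappa>) * (D / d) powr \<kappa>"
    by (intro order_trans[OF Q_le[OF order_refl assms(1)]] mult_left_mono) simp_all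
  also have "\<dots> = \<bar>v\<bar> * (2 / \<tau>\<^sup>2 * (D / d) powr leja_alpha \<tau>)"
    by (simp add: leja_alpha_def \<kappa>_def add.commute mult.assoc flip: powr_add)
  finally have "\<bar>v\<bar> * (g v * (\<Prod>l<N. \<bar>v - z l\<bar> / \<bar>z l\<bar>)) \<le> \<bar>v\<bar> * (2 / \<tau>\<^sup>2 * (D / d) powr leja_alpha \<tau>)"
    by (simp add: Q_def mult_ac)
  then show ?thesis by (rule mult_left_le_imp_le) (use assms(2) in auto)
qed

end

section \<open>Separation of the zeros of a polynomial from its large values\<close>

text \<open>
  The Bernstein-Walsh inequality: with \<open>t = (w + 1 / w) / 2\<close>, the product times \<open>w ^ m\<close> is a
  polynomial in \<open>w\<close>, and the maximum principle on the unit disc applies to it, because \<open>t\<close> runs through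
  \<open>[-1, 1]\<close> on the unit circle.
\<close>

lemma joukowski_bound:
  fixes c :: "nat \<Rightarrow> real" and w :: complex
  assumes bound: "\<And>t. -1 \<le> t \<Longrightarrow> t \<le> 1 \<Longrightarrow> (\<Prod>j<m. \<bar>t - c j\<bar>) \<le> M"
    and w: "w \<noteq> 0" "cmod w \<le> 1"
  shows "(\<Prod>j<m. cmod ((w + 1 / w) / 2 - of_real (c j))) \<le> M / cmod w ^ m"
proof -
  define h where "h = (\<lambda>w::complex. \<Prod>j<m. (w\<^sup>2 + 1 - 2 * of_real (c j) * w) / 2)"
  have h_eq: "cmod (h v) = cmod v ^ m * (\<Prod>j<m. cmod ((v + 1 / v) / 2 - of_real (c j)))"
    if "v \<noteq> 0" for v
  proof -
    have "(v\<^sup>2 + 1 - 2 * of_real (c j) * v) / 2 = v * ((v + 1 / v) / 2 - of_real (c j))" for j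
      using that by (simp add: field_simps power2_eq_square)
    then show ?thesis
      by (simp only: h_def norm_mult prod.distrib prod_constant card_lessThan norm_power flip: prod_norm)
  qed
  have "cmod (h w) \<le> M"
  proof (rule maximum_modulus_frontier[of h "cball 0 1"])
    show "h holomorphic_on interior (cball 0 1)" unfolding h_def by (intro holomorphic_intros) auto
    show "continuous_on (closure (cball 0 1)) h" unfolding h_def by (intro continuous_intros) auto
    show "cmod (h v) \<le> M" if "v \<in> frontier (cball 0 1)" for v
    proof -
      have v: "cmod v = 1" using that by (simp add: frontier_cball)
      then have "v \<noteq> 0" by auto
      have "v * cnj v = 1" using v by (simp flip: complex_norm_square)
      then have "1 / v = cnj v" using \<open>v \<noteq> 0\<close> by (simp add: field_simps)
      then have "(v + 1 / v) / 2 = of_real (Re v)" by (simp add: complex_add_cnj)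
      then have "cmod (h v) = (\<Prod>j<m. \<bar>Re v - c j\<bar>)"
        unfolding h_eq[OF \<open>v \<noteq> 0\<close>] v by (simp flip: of_real_diff)
      then show ?thesis using bound[of "Re v"] abs_Re_le_cmod[of v] v by simp
    qed
  qed (use w in auto)
  then show ?thesis using w by (simp add: h_eq field_simps)
qed

lemma cos_product_bound:
  fixes c :: "nat \<Rightarrow> real" and z :: complex
  assumes bound: "\<And>t. -1 \<le> t \<Longrightarrow> t \<le> 1 \<Longrightarrow> (\<Prod>j<m. \<bar>t - c j\<bar>) \<le> M"
  shows "cmod (\<Prod>j<m. cos z - of_real (c j)) \<le> M * exp (real m * \<bar>Im z\<bar>)"
proof -
  define w where "w = (if 0 \<le> Im z then exp (\<i> * z) else exp (- (\<i> * z)))"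
  have w: "w \<noteq> 0" "cmod w = exp (- \<bar>Im z\<bar>)" by (auto simp: w_def)
  have "cos z = (w + 1 / w) / 2"
    by (simp add: w_def cos_exp_eq exp_minus inverse_eq_divide add.commute)
  then have "cmod (\<Prod>j<m. cos z - of_real (c j)) \<le> M / cmod w ^ m"
    using joukowski_bound[OF bound w(1)] w by (simp only: prod_norm[symmetric]) simp
  also have "\<dots> = M * exp (real m * \<bar>Im z\<bar>)"
    unfolding w by (simp add: exp_of_nat_mult[symmetric] exp_minus field_simps)
  finally show ?thesis .
qed

text \<open>
  If \<open>z = cos u\<close> then \<open>\<bar>z - 1\<bar> + \<bar>z + 1\<bar> = 2 * cosh (Im u)\<close>. Within distance \<open>1 / (2 * m\<^sup>2)\<close> of the
  interval the left side is at most \<open>2 + 1 / m\<^sup>2\<close>, and so \<open>\<bar>Im u\<bar> \<le> 1 / m\<close>.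
\<close>

lemma ellipse_bound:
  fixes c :: "nat \<Rightarrow> real" and z :: complex
  assumes bound: "\<And>t. -1 \<le> t \<Longrightarrow> t \<le> 1 \<Longrightarrow> (\<Prod>j<m. \<bar>t - c j\<bar>) \<le> M"
    and M: "0 \<le> M" and x: "-1 \<le> x" "x \<le> 1" and m: "m > 0"
    and z: "cmod (z - of_real x) \<le> 1 / (2 * (real m)\<^sup>2)"
  shows "cmod (\<Prod>j<m. z - of_real (c j)) \<le> M * exp 1"
proof -
  define u where "u = Arccos z"
  have cos_u: "cos u = z" by (simp add: u_def)
  define E where "E = exp (Im u)"
  have sin_half: "cmod (cos v - 1) = (exp (Im v) + inverse (exp (Im v)) - 2 * cos (Re v)) / 2" for v
  proof -
    have "cos v = 1 - 2 * (sin (v / 2))\<^sup>2" using cos_double_sin[of "v / 2"] by simp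
    then have "cmod (cos v - 1) = 2 * (cmod (sin (v / 2)))\<^sup>2" by (simp add: norm_mult norm_power)
    then show ?thesis by (simp add: norm_sin_squared)
  qed
  have "cmod (z - 1) = (E + inverse E - 2 * cos (Re u)) / 2"
    using sin_half[of u] by (simp add: cos_u E_def)
  moreover have "cmod (z + 1) = (E + inverse E + 2 * cos (Re u)) / 2"
  proof -
    have "cos (u + of_real pi) = - z"
      using cos_add[of u "of_real pi"] by (simp add: cos_u cos_of_real sin_of_real)
    then have "cmod (z + 1) = cmod (cos (u + of_real pi) - 1)"
      by (metis minus_diff_eq norm_minus_cancel add.commute diff_minus_eq_add)
    then show ?thesis unfolding sin_half by (simp add: E_def)
  qed
  ultimately have "E + inverse E = cmod (z - 1) + cmod (z + 1)" by simp
  also have "\<dots> \<le> (cmod (z - of_real x) + cmod (of_real x - 1)) + (cmod (z - of_real x) + cmod (of_real x + 1))"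
    using norm_triangle_ineq[of "z - of_real x" "of_real x - 1"]
      norm_triangle_ineq[of "z - of_real x" "of_real x + 1"] by (simp add: algebra_simps)
  also have "cmod (of_real x - 1) = 1 - x"
    using norm_of_real[of "x - 1", where ?'a = complex] x by simp
  also have "cmod (of_real x + 1) = 1 + x"
    using norm_of_real[of "x + 1", where ?'a = complex] x by simp
  finally have "E + inverse E - 2 \<le> 1 / (real m)\<^sup>2" using z by simp
  moreover have "(Im u)\<^sup>2 \<le> E + inverse E - 2"
  proof -
    define h where "h = exp (Im u / 2)"
    have h: "0 < h" "E = h\<^sup>2" by (auto simp: h_def E_def simp flip: exp_double)
    have "\<bar>Im u / 2\<bar> \<le> \<bar>(h - inverse h) / 2\<bar>" unfolding h_def by (rule real_le_abs_sinh)
    then have "(Im u)\<^sup>2 \<le> (h - inverse h)\<^sup>2" by (simp add: abs_le_square_iff[symmetric])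
    also have "\<dots> = E + inverse E - 2" using h by (simp add: power2_eq_square field_simps)
    finally show ?thesis .
  qed
  ultimately have "(Im u)\<^sup>2 \<le> (1 / real m)\<^sup>2" by (simp add: power_divide)
  then have "\<bar>Im u\<bar> \<le> 1 / real m" by (simp add: abs_le_square_iff[symmetric])
  then have "real m * \<bar>Im u\<bar> \<le> 1" using m by (simp add: field_simps)
  then have "M * exp (real m * \<bar>Im u\<bar>) \<le> M * exp 1" using M by (intro mult_left_mono) auto
  then show ?thesis using cos_product_bound[OF bound, of u] cos_u by simp
qed

text \<open>
  Cauchy's estimate on circles of radius \<open>r\<close> around the points of the segment bounds the derivative.
\<close>

lemma lipschitz_of_cauchy:
  fixes F :: "complex \<Rightarrow> complex" and a b r B :: real
  assumes F: "F holomorphic_on UNIV" and r: "0 < r"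
    and B: "\<And>t z. t \<in> closed_segment a b \<Longrightarrow> cmod (of_real t - z) = r \<Longrightarrow> cmod (F z) \<le> B"
  shows "cmod (F (of_real a) - F (of_real b)) \<le> B / r * \<bar>a - b\<bar>"
proof -
  let ?S = "closed_segment (of_real a) (of_real b) :: complex set"
  have "cmod (F (of_real a) - F (of_real b)) \<le> B / r * cmod (of_real a - of_real b)"
  proof (rule field_differentiable_bound[of ?S F "deriv F"])
    show "(F has_field_derivative deriv F z) (at z within ?S)" for z
      using F by (simp add: holomorphic_derivI has_field_derivative_at_within)
    show "cmod (deriv F z) \<le> B / r" if zS: "z \<in> ?S" for z
    proof -
      obtain t where t: "z = of_real t" "t \<in> closed_segment a b"
        using zS unfolding closed_segment_of_real by blast
      have "cmod ((deriv ^^ 1) F z) \<le> fact 1 * B / r ^ 1"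
        using F r B[OF t(2)] unfolding t(1)
        by (intro Cauchy_inequality)
          (auto intro: holomorphic_on_subset holomorphic_on_imp_continuous_on)
      then show ?thesis by simp
    qed
  qed auto
  then show ?thesis by (simp flip: of_real_diff)
qed

text \<open>
  Cauchy estimates bound the derivative of the product \<open>P\<close> in the variable \<open>t = cos \<phi>\<close> by
  \<open>e * M * m\<close> with respect to \<open>\<phi>\<close>, and by \<open>2 * e * M * m\<^sup>2\<close> with respect to \<open>t\<close>. The difference
  of the values of \<open>P\<close> at \<open>c i\<close>, where it vanishes, and at \<open>q\<close> is at least \<open>\<tau> * M\<close>.
\<close>

lemma node_separation:
  fixes c :: "nat \<Rightarrow> real"
  assumes bound: "\<And>t. -1 \<le> t \<Longrightarrow> t \<le> 1 \<Longrightarrow> (\<Prod>j<m. \<bar>t - c j\<bar>) \<le> M"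
    and M: "0 < M" and i: "i < m" and p: "-1 \<le> c i" "c i \<le> 1" and q: "-1 \<le> q" "q \<le> 1"
    and big: "\<tau> * M \<le> (\<Prod>j<m. \<bar>q - c j\<bar>)"
  shows node_separation_angle: "\<tau> / (exp 1 * real m) \<le> \<bar>arccos (c i) - arccos q\<bar>"
    and node_separation_dist: "\<tau> / (2 * exp 1 * (real m)\<^sup>2) \<le> \<bar>c i - q\<bar>"
proof -
  have m: "m > 0" using i by simp
  define G where "G = (\<lambda>z::complex. \<Prod>j<m. z - of_real (c j))"
  have G_p: "G (of_real (c i)) = 0" unfolding G_def using i by (auto intro!: prod_zero)
  have "cmod (G (of_real q)) = (\<Prod>j<m. \<bar>q - c j\<bar>)"
    by (simp add: G_def flip: prod_norm of_real_diff)
  then have G_q: "\<tau> * M \<le> cmod (G (of_real (c i)) - G (of_real q))" using big G_p by simp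
  have "cmod (G (cos (of_real (arccos (c i)))) - G (cos (of_real (arccos q))))
      \<le> M * exp 1 / (1 / m) * \<bar>arccos (c i) - arccos q\<bar>"
  proof (rule lipschitz_of_cauchy)
    show "(\<lambda>z. G (cos z)) holomorphic_on UNIV" unfolding G_def by (intro holomorphic_intros)
    show "cmod (G (cos z)) \<le> M * exp 1" if "cmod (of_real t - z) = 1 / real m" for t z
    proof -
      have "\<bar>Im z\<bar> \<le> 1 / real m" using abs_Im_le_cmod[of "of_real t - z"] that by simp
      then have "real m * \<bar>Im z\<bar> \<le> 1" using m by (simp add: field_simps)
      then have "M * exp (real m * \<bar>Im z\<bar>) \<le> M * exp 1" using M by (intro mult_left_mono) auto
      then show ?thesis using cos_product_bound[OF bound, of z] by (simp add: G_def)
    qed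
  qed (use m in auto)
  then have "\<tau> * M \<le> M * (exp 1 * real m * \<bar>arccos (c i) - arccos q\<bar>)"
    using G_q p q by (simp add: cos_of_real cos_arccos mult_ac)
  then have "\<tau> \<le> exp 1 * real m * \<bar>arccos (c i) - arccos q\<bar>" using M by (simp add: mult.commute)
  then show "\<tau> / (exp 1 * real m) \<le> \<bar>arccos (c i) - arccos q\<bar>"
    using m by (simp add: pos_divide_le_eq mult.commute)
  have "cmod (G (of_real (c i)) - G (of_real q)) \<le> M * exp 1 / (1 / (2 * (real m)\<^sup>2)) * \<bar>c i - q\<bar>"
  proof (rule lipschitz_of_cauchy)
    show "G holomorphic_on UNIV" unfolding G_def by (intro holomorphic_intros)
    show "cmod (G z) \<le> M * exp 1"
      if "t \<in> closed_segment (c i) q" "cmod (of_real t - z) = 1 / (2 * (real m)\<^sup>2)" for t z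
    proof -
      have "-1 \<le> t" "t \<le> 1" using that(1) p q by (auto simp: closed_segment_eq_real_ivl split: if_splits)
      then show ?thesis unfolding G_def
        using ellipse_bound[OF bound, of t z] M m that(2) by (simp add: norm_minus_commute)
    qed
  qed (use m in auto)
  then have "\<tau> * M \<le> M * (2 * exp 1 * (real m)\<^sup>2 * \<bar>c i - q\<bar>)"
    using G_q by (simp add: mult_ac)
  then have "\<tau> \<le> 2 * exp 1 * (real m)\<^sup>2 * \<bar>c i - q\<bar>" using M by (simp add: mult.commute)
  then show "\<tau> / (2 * exp 1 * (real m)\<^sup>2) \<le> \<bar>c i - q\<bar>"
    using m by (simp add: pos_divide_le_eq mult.commute)
qed

section \<open>Sums over separated angles\<close>

lemma sin_ge_cubic:
  fixes t :: real
  assumes "0 \<le> t"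
  shows "t * (1 - t\<^sup>2 / 6) \<le> sin t"
proof -
  have "\<bar>sin t - t\<bar> \<le> inverse (fact 3) * \<bar>t\<bar> ^ 3"
    using Maclaurin_sin_bound[of t 3] by (simp add: eval_nat_numeral sin_coeff_def)
  also have "inverse (fact 3) * \<bar>t\<bar> ^ 3 = t * (t\<^sup>2 / 6)"
    using assms by (simp add: eval_nat_numeral)
  finally have "t - t * (t\<^sup>2 / 6) \<le> sin t" by linarith
  then show ?thesis by (simp add: right_diff_distrib)
qed

text \<open>
  In absolute value, the difference of the cosines is smallest when \<open>\<phi>'\<close> is \<open>\<phi> - s\<close>, and then equals
  \<open>2 * sin (\<phi> - s / 2) * sin (s / 2)\<close>.
\<close>

lemma cos_gap_half:
  fixes \<phi> \<phi>' s :: real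
  assumes \<phi>: "\<phi> \<le> pi / 2" and \<phi>': "0 \<le> \<phi>'" "\<phi>' \<le> pi"
    and s: "0 < s" "s \<le> 2/5" "s \<le> 2/5 * \<phi>" and gap: "s \<le> \<bar>\<phi> - \<phi>'\<bar>"
  shows "s * \<phi> / pi \<le> \<bar>cos \<phi> - cos \<phi>'\<bar>"
proof -
  have \<phi>0: "0 < \<phi>" using s by auto
  define A where "A = sin (s / 2)"
  define B where "B = sin (\<phi> - s / 2)"
  \<comment> \<open>Since \<open>\<pi> / 2 \<le> 8/5\<close>, the cubic bound keeps enough of the sine to beat \<open>1 / \<pi>\<close>.\<close>
  have A: "99/100 * (s / 2) \<le> A"
  proof -
    have "(s / 2)\<^sup>2 \<le> (1/5)\<^sup>2" using s by (intro power_mono) auto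
    then have "99/100 \<le> 1 - (s / 2)\<^sup>2 / 6" by (simp add: power2_eq_square)
    then have "s / 2 * (99/100) \<le> s / 2 * (1 - (s / 2)\<^sup>2 / 6)" using s by (intro mult_left_mono) auto
    also have "\<dots> \<le> A" unfolding A_def using s by (intro sin_ge_cubic) auto
    finally show ?thesis by (simp only: mult.commute)
  qed
  have B: "57/100 * (4/5 * \<phi>) \<le> B"
  proof -
    define t where "t = \<phi> - s / 2"
    have t: "4/5 * \<phi> \<le> t" "t \<le> 8/5" using s \<phi> pi_approx(2) by (auto simp: t_def)
    have "t\<^sup>2 \<le> (8/5)\<^sup>2" using t \<phi>0 by (intro power_mono) auto
    then have "57/100 \<le> 1 - t\<^sup>2 / 6" by (simp add: power2_eq_square)
    then have "(4/5 * \<phi>) * (57/100) \<le> t * (1 - t\<^sup>2 / 6)" using t \<phi>0 by (intro mult_mono) auto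
    also have "\<dots> \<le> B" unfolding B_def t_def[symmetric] using t \<phi>0 by (intro sin_ge_cubic) auto
    finally show ?thesis by (simp only: mult.commute)
  qed
  have AB: "s * \<phi> / pi \<le> 2 * B * A"
  proof -
    have "s * \<phi> / pi \<le> s * \<phi> / 3" using s \<phi>0 pi_gt3 by (intro divide_left_mono) auto
    also have "\<dots> \<le> 2 * (57/100 * (4/5 * \<phi>)) * (99/100 * (s / 2))"
      using mult_pos_pos[OF s(1) \<phi>0] by (simp add: mult.commute)
    also have "\<dots> \<le> 2 * B * A" using A B s \<phi>0 by (intro mult_mono) auto
    finally show ?thesis .
  qed
  consider "\<phi> + s \<le> \<phi>'" | "\<phi>' \<le> \<phi> - s" using gap by linarith
  then show ?thesis
  proof cases
    case 1
    have "cos \<phi>' \<le> cos (\<phi> + s)" using 1 \<phi>' s \<phi>0 by (intro cos_monotone_0_pi_le) auto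
    moreover have "cos \<phi> - cos (\<phi> + s) = 2 * sin (\<phi> + s / 2) * A"
    proof -
      have "(\<phi> + (\<phi> + s)) / 2 = \<phi> + s / 2" "(\<phi> + s - \<phi>) / 2 = s / 2" by auto
      then show ?thesis using cos_diff_cos[of \<phi> "\<phi> + s"] by (simp only: A_def)
    qed
    moreover have "B \<le> sin (\<phi> + s / 2)"
    proof -
      have "sin (\<phi> + s / 2) - B = 2 * (A * cos \<phi>)"
        by (simp add: sin_add sin_diff A_def B_def)
      moreover have "0 \<le> cos \<phi>" using \<phi> \<phi>0 by (intro cos_ge_zero) auto
      moreover have "0 \<le> A" using A s by linarith
      ultimately show ?thesis by (metis diff_ge_0_iff_ge mult_nonneg_nonneg zero_le_numeral)
    qed
    moreover have "0 \<le> A" using A s by linarith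
    ultimately have "2 * B * A \<le> cos \<phi> - cos \<phi>'"
      using mult_right_mono[of "2 * B" "2 * sin (\<phi> + s / 2)" A] by linarith
    then show ?thesis using AB by linarith
  next
    case 2
    have "cos (\<phi> - s) \<le> cos \<phi>'" using 2 \<phi>' s \<phi>0 \<phi> by (intro cos_monotone_0_pi_le) auto
    moreover have "cos (\<phi> - s) - cos \<phi> = 2 * B * A"
    proof -
      have "(\<phi> - s + \<phi>) / 2 = \<phi> - s / 2" "(\<phi> - (\<phi> - s)) / 2 = s / 2" by auto
      then show ?thesis using cos_diff_cos[of "\<phi> - s" \<phi>] by (simp only: A_def B_def)
    qed
    ultimately show ?thesis using AB by linarith
  qed
qed

lemma cos_gap:
  fixes \<phi> \<phi>' s :: real
  defines "\<psi> \<equiv> min \<phi> (pi - \<phi>)"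
  assumes "0 \<le> \<phi>'" "\<phi>' \<le> pi"
    and "0 < s" "s \<le> 2/5" "s \<le> 2/5 * \<psi>" and "s \<le> \<bar>\<phi> - \<phi>'\<bar>"
  shows "s * \<psi> / pi \<le> \<bar>cos \<phi> - cos \<phi>'\<bar>"
proof (cases "\<phi> \<le> pi / 2")
  case True
  then have "\<psi> = \<phi>" by (simp add: \<psi>_def)
  then show ?thesis using assms True cos_gap_half[of \<phi> \<phi>' s] by simp
next
  case False
  then have "\<psi> = pi - \<phi>" by (simp add: \<psi>_def)
  then show ?thesis
    using assms False cos_gap_half[of "pi - \<phi>" "pi - \<phi>'" s] by (simp add: abs_minus_commute)
qed

text \<open>
  Comparison of a sum over separated points with an integral, where \<open>H\<close> plays the role of
  \<open>1 / s\<close> times the integral of \<open>h\<close> from the given point on. The points are added in decreasing order.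
\<close>

lemma separated_sum_le:
  fixes A :: "real set" and h H :: "real \<Rightarrow> real"
  assumes "finite A" "A \<noteq> {}" "A \<subseteq> {c..b}"
    and "\<And>x y. x \<in> A \<Longrightarrow> y \<in> A \<Longrightarrow> x \<noteq> y \<Longrightarrow> s \<le> \<bar>x - y\<bar>"
    and step: "\<And>x y. c \<le> x \<Longrightarrow> x + s \<le> y \<Longrightarrow> y \<le> b \<Longrightarrow> h y + H y \<le> H x"
    and H: "\<And>x. c \<le> x \<Longrightarrow> x \<le> b \<Longrightarrow> 0 \<le> H x"
  shows "sum h A \<le> h (Min A) + H (Min A)"
  using assms(1-4)
proof (induction A rule: finite_linorder_min_induct)
  case empty
  then show ?case by simp
next
  case (insert m A)
  have m: "c \<le> m" "m \<le> b" "m \<notin> A" using insert by auto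
  have Min: "Min (insert m A) = m" using insert by (intro Min_eqI) auto
  show ?case
  proof (cases "A = {}")
    case True
    then show ?thesis using H[of m] m by simp
  next
    case False
    have M: "Min A \<in> A" using False insert by simp
    have "sum h A \<le> h (Min A) + H (Min A)"
      using insert.prems False by (intro insert.IH) auto
    also have "\<dots> \<le> H m"
    proof (rule step)
      have "s \<le> \<bar>m - Min A\<bar>" using M insert.prems m by (intro insert.prems) auto
      then show "m + s \<le> Min A" using insert.hyps(2) M by force
      show "Min A \<le> b" using insert.prems M by auto
    qed (use m in auto)
    finally show ?thesis using insert m by (simp add: Min del: Min_insert)
  qed
qed

text \<open>
  The convex function \<open>x powr (1 - \<alpha>)\<close> lies above its tangent at \<open>y\<close>.
\<close>

lemma powr_tangent_step:
  fixes x y s \<alpha> :: real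
  assumes "0 < x" "0 < s" "x + s \<le> y" "1 < \<alpha>"
  shows "y powr (- \<alpha>) + y powr (1 - \<alpha>) / (s * (\<alpha> - 1)) \<le> x powr (1 - \<alpha>) / (s * (\<alpha> - 1))"
proof -
  define \<beta> where "\<beta> = \<alpha> - 1"
  have \<beta>: "0 < \<beta>" using assms by (simp add: \<beta>_def)
  have y: "0 < y" using assms by linarith
  define t where "t = x / y"
  have t: "0 < t" "s / y \<le> 1 - t" using assms y by (auto simp: t_def field_simps)
  have "1 + \<beta> * (s / y) \<le> 1 + \<beta> * (1 - t)"
    using t \<beta> by (intro add_left_mono mult_left_mono) auto
  also have "\<dots> \<le> 1 + (- \<beta>) * ln t"
    using mult_left_mono[OF ln_le_minus_one[OF t(1)], of \<beta>] \<beta> by (simp add: algebra_simps)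
  also have "\<dots> \<le> exp ((- \<beta>) * ln t)" by (rule exp_ge_add_one_self)
  also have "\<dots> = t powr (- \<beta>)" using t by (simp add: powr_def)
  also have "\<dots> = x powr (- \<beta>) / y powr (- \<beta>)" using assms y by (simp add: t_def powr_divide)
  finally have "(1 + \<beta> * (s / y)) * y powr (- \<beta>) \<le> x powr (- \<beta>)"
    using y by (simp add: pos_le_divide_eq)
  moreover have "y powr (- \<alpha>) = y powr (- \<beta>) / y"
    using y by (simp add: \<beta>_def powr_diff powr_minus divide_simps)
  ultimately have "(s * \<beta>) * y powr (- \<alpha>) + y powr (- \<beta>) \<le> x powr (- \<beta>)"
    by (simp add: algebra_simps)
  then have "((s * \<beta>) * y powr (- \<alpha>) + y powr (- \<beta>)) / (s * \<beta>) \<le> x powr (- \<beta>) / (s * \<beta>)"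
    using assms \<beta> by (intro divide_right_mono) auto
  then have "y powr (- \<alpha>) + y powr (- \<beta>) / (s * \<beta>) \<le> x powr (- \<beta>) / (s * \<beta>)"
    using assms \<beta> by (simp add: add_divide_distrib)
  then show ?thesis by (simp add: \<beta>_def)
qed

lemma card_separated_le:
  fixes A :: "real set"
  assumes "finite A" "A \<subseteq> {0..b}" "0 < s" "0 \<le> b"
    and sep: "\<And>x y. x \<in> A \<Longrightarrow> y \<in> A \<Longrightarrow> x \<noteq> y \<Longrightarrow> s \<le> \<bar>x - y\<bar>"
  shows "real (card A) \<le> 1 + b / s"
proof (cases "A = {}")
  case True
  then show ?thesis using assms by simp
next
  case False
  have "sum (\<lambda>_. 1) A \<le> 1 + (b - Min A) / s"
  proof (rule separated_sum_le[where c = 0 and b = b and s = s])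
    show "1 + (b - y) / s \<le> (b - x) / s" if "x + s \<le> y" for x y
    proof -
      have "1 + (b - y) / s = (s + (b - y)) / s" using assms by (simp add: add_divide_distrib)
      also have "\<dots> \<le> (b - x) / s" using that assms by (intro divide_right_mono) auto
      finally show ?thesis .
    qed
  qed (use assms False in auto)
  moreover have "0 \<le> Min A" using assms False by (meson Min_in atLeastAtMost_iff subsetD)
  then have "(b - Min A) / s \<le> b / s" using assms by (intro divide_right_mono) auto
  ultimately show ?thesis by simp
qed

lemma sum_powr_separated_le:
  fixes A :: "real set"
  assumes "finite A" "A \<subseteq> {c..}" "0 < s" "0 < c" "1 < \<alpha>"
    and sep: "\<And>x y. x \<in> A \<Longrightarrow> y \<in> A \<Longrightarrow> x \<noteq> y \<Longrightarrow> s \<le> \<bar>x - y\<bar>"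
  shows "(\<Sum>x\<in>A. x powr (- \<alpha>)) \<le> c powr (- \<alpha>) + c powr (1 - \<alpha>) / (s * (\<alpha> - 1))"
proof (cases "A = {}")
  case True
  then show ?thesis using assms by simp
next
  case False
  have m: "c \<le> Min A" using assms False by (meson Min_in atLeast_iff subsetD)
  have "(\<Sum>x\<in>A. x powr (- \<alpha>)) \<le> Min A powr (- \<alpha>) + Min A powr (1 - \<alpha>) / (s * (\<alpha> - 1))"
  proof (rule separated_sum_le[where c = c and b = "Max A" and s = s])
    show "A \<subseteq> {c..Max A}" using assms by auto
    show "y powr (- \<alpha>) + y powr (1 - \<alpha>) / (s * (\<alpha> - 1)) \<le> x powr (1 - \<alpha>) / (s * (\<alpha> - 1))"
      if "c \<le> x" "x + s \<le> y" for x y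
      using that assms by (intro powr_tangent_step) auto
  qed (use assms False in auto)
  also have "\<dots> \<le> c powr (- \<alpha>) + c powr (1 - \<alpha>) / (s * (\<alpha> - 1))"
    using m assms by (intro add_mono divide_right_mono powr_mono2') auto
  finally show ?thesis .
qed

text \<open>
  A lower bound for the distance, on the scale of \<open>[-1, 1]\<close>, to the other nodes from a node at angular
  distance \<open>\<psi>\<close> from the endpoints. The angular separation \<open>\<tau> / (e * n)\<close> alone would give only a multiple
  of \<open>\<tau>\<^sup>2 / n\<^sup>2\<close> near the endpoints.
\<close>

definition angle_gap :: "real \<Rightarrow> nat \<Rightarrow> real \<Rightarrow> real" where
  "angle_gap \<tau> n \<psi> =
     (if \<psi> \<le> 1 / real n then \<tau> / (2 * exp 1 * (real n)\<^sup>2) else \<tau> / (exp 1 * real n) * \<psi> / pi)"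

text \<open>
  The two summands come from the nodes at angular distance at most \<open>1 / n\<close> from one endpoint, of
  which there are at most \<open>1 + e / \<tau>\<close>, and from the other nodes in the same half of the interval.
\<close>

definition gap_sum_const :: "real \<Rightarrow> real \<Rightarrow> real" where
  "gap_sum_const \<tau> \<alpha> = (1 + exp 1 / \<tau>) * (2 * exp 1 / \<tau>) powr \<alpha> +
     (pi * exp 1 / \<tau>) powr \<alpha> * (1 + exp 1 / (\<tau> * (\<alpha> - 1)))"

lemma angle_gap_sum_half:
  fixes A :: "real set"
  assumes A: "finite A" "A \<subseteq> {0..}" and \<tau>: "0 < \<tau>" and \<alpha>: "1 < \<alpha>" and n: "1 \<le> n"
    and sep: "\<And>x y. x \<in> A \<Longrightarrow> y \<in> A \<Longrightarrow> x \<noteq> y \<Longrightarrow> \<tau> / (exp 1 * real n) \<le> \<bar>x - y\<bar>"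
  shows "(\<Sum>\<psi>\<in>A. angle_gap \<tau> n \<psi> powr (- \<alpha>)) \<le> gap_sum_const \<tau> \<alpha> * real n powr (2 * \<alpha>)"
proof -
  define s where "s = \<tau> / (exp 1 * real n)"
  have s: "0 < s" using \<tau> n by (simp add: s_def)
  have n0: "0 < real n" using n by simp
  define A0 where "A0 = {\<psi>\<in>A. \<psi> \<le> 1 / real n}"
  define A1 where "A1 = {\<psi>\<in>A. 1 / real n < \<psi>}"
  have sepA: "s \<le> \<bar>x - y\<bar>" if "x \<in> A" "y \<in> A" "x \<noteq> y" for x y using sep that by (simp add: s_def)
  have fin: "finite A0" "finite A1" using A by (auto simp: A0_def A1_def)
  have near: "(\<Sum>\<psi>\<in>A0. angle_gap \<tau> n \<psi> powr (- \<alpha>))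
      \<le> (1 + exp 1 / \<tau>) * (2 * exp 1 / \<tau>) powr \<alpha> * real n powr (2 * \<alpha>)"
  proof -
    have "real (card A0) \<le> 1 + (1 / real n) / s"
      using A fin s n0 sepA by (intro card_separated_le) (auto simp: A0_def)
    also have "(1 / real n) / s = exp 1 / \<tau>" using n0 by (simp add: s_def)
    finally have card: "real (card A0) \<le> 1 + exp 1 / \<tau>" .
    have "(\<tau> / (2 * exp 1 * (real n)\<^sup>2)) powr (- \<alpha>) = (2 * exp 1 / \<tau> * (real n)\<^sup>2) powr \<alpha>"
      using \<tau> n0 by (simp add: powr_minus_divide powr_divide powr_mult)
    also have "\<dots> = (2 * exp 1 / \<tau>) powr \<alpha> * real n powr (2 * \<alpha>)"
    proof -
      have "((real n)\<^sup>2) powr \<alpha> = real n powr (2 * \<alpha>)"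
        using n0 powr_powr[of "real n" 2 \<alpha>] by (simp add: powr_realpow)
      then show ?thesis using \<tau> powr_mult[of "2 * exp 1 / \<tau>" "(real n)\<^sup>2" \<alpha>] by simp
    qed
    finally have "(\<Sum>\<psi>\<in>A0. angle_gap \<tau> n \<psi> powr (- \<alpha>))
        = real (card A0) * ((2 * exp 1 / \<tau>) powr \<alpha> * real n powr (2 * \<alpha>))"
      by (simp add: A0_def angle_gap_def)
    also have "\<dots> \<le> (1 + exp 1 / \<tau>) * ((2 * exp 1 / \<tau>) powr \<alpha> * real n powr (2 * \<alpha>))"
      using card by (intro mult_right_mono) auto
    finally show ?thesis by (simp add: mult.assoc)
  qed
  have far: "(\<Sum>\<psi>\<in>A1. angle_gap \<tau> n \<psi> powr (- \<alpha>))
      \<le> (pi * exp 1 / \<tau>) powr \<alpha> * (1 + exp 1 / (\<tau> * (\<alpha> - 1))) * real n powr (2 * \<alpha>)"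
  proof -
    have gap: "angle_gap \<tau> n \<psi> powr (- \<alpha>) = (pi / s) powr \<alpha> * \<psi> powr (- \<alpha>)" if "\<psi> \<in> A1" for \<psi>
    proof -
      have "1 / real n < \<psi>" using that by (simp add: A1_def)
      moreover have "0 < 1 / real n" using n0 by simp
      ultimately have "0 < \<psi>" "angle_gap \<tau> n \<psi> = s * \<psi> / pi"
        by (linarith, simp add: angle_gap_def s_def)
      then show ?thesis using s by (simp add: powr_minus_divide powr_divide powr_mult)
    qed
    have "(\<Sum>\<psi>\<in>A1. angle_gap \<tau> n \<psi> powr (- \<alpha>)) = (pi / s) powr \<alpha> * (\<Sum>\<psi>\<in>A1. \<psi> powr (- \<alpha>))"
      by (simp add: gap sum_distrib_left)
    also have "\<dots> \<le> (pi / s) powr \<alpha> *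
        ((1 / real n) powr (- \<alpha>) + (1 / real n) powr (1 - \<alpha>) / (s * (\<alpha> - 1)))"
      using fin s n0 \<alpha> sepA by (intro mult_left_mono sum_powr_separated_le) (auto simp: A1_def)
    also have "(1 / real n) powr (1 - \<alpha>) / (s * (\<alpha> - 1)) = real n powr \<alpha> * (exp 1 / (\<tau> * (\<alpha> - 1)))"
      using n0 by (simp add: s_def powr_divide powr_diff)
    also have "(1 / real n) powr (- \<alpha>) = real n powr \<alpha>"
      using n0 by (simp add: powr_divide powr_minus_divide)
    also have "(pi / s) powr \<alpha> = (pi * exp 1 / \<tau>) powr \<alpha> * real n powr \<alpha>"
    proof -
      have "pi / s = pi * exp 1 / \<tau> * real n" by (simp add: s_def)
      then show ?thesis using \<tau> powr_mult[of "pi * exp 1 / \<tau>" "real n" \<alpha>] by simp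
    qed
    also have "(pi * exp 1 / \<tau>) powr \<alpha> * real n powr \<alpha> *
        (real n powr \<alpha> + real n powr \<alpha> * (exp 1 / (\<tau> * (\<alpha> - 1))))
        = (pi * exp 1 / \<tau>) powr \<alpha> * (1 + exp 1 / (\<tau> * (\<alpha> - 1))) * (real n powr \<alpha> * real n powr \<alpha>)"
      by (simp add: algebra_simps)
    also have "real n powr \<alpha> * real n powr \<alpha> = real n powr (2 * \<alpha>)"
      by (simp only: mult_2 powr_add)
    finally show ?thesis .
  qed
  have "A = A0 \<union> A1" "A0 \<inter> A1 = {}" by (auto simp: A0_def A1_def)
  then have "(\<Sum>\<psi>\<in>A. angle_gap \<tau> n \<psi> powr (- \<alpha>))
      = (\<Sum>\<psi>\<in>A0. angle_gap \<tau> n \<psi> powr (- \<alpha>)) + (\<Sum>\<psi>\<in>A1. angle_gap \<tau> n \<psi> powr (- \<alpha>))"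
    using fin by (simp add: sum.union_disjoint)
  then show ?thesis using near far by (simp add: gap_sum_const_def distrib_right)
qed

text \<open>
  The nodes are divided according to the endpoint that is closer.
\<close>

lemma angle_gap_sum:
  fixes \<phi> :: "'a \<Rightarrow> real"
  assumes J: "finite J" and \<phi>: "\<And>k. k \<in> J \<Longrightarrow> 0 \<le> \<phi> k \<and> \<phi> k \<le> pi"
    and \<tau>: "0 < \<tau>" and \<alpha>: "1 < \<alpha>" and n: "1 \<le> n"
    and sep: "\<And>k l. k \<in> J \<Longrightarrow> l \<in> J \<Longrightarrow> k \<noteq> l \<Longrightarrow> \<tau> / (exp 1 * real n) \<le> \<bar>\<phi> k - \<phi> l\<bar>"
  shows "(\<Sum>k\<in>J. angle_gap \<tau> n (min (\<phi> k) (pi - \<phi> k)) powr (- \<alpha>))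
    \<le> 2 * gap_sum_const \<tau> \<alpha> * real n powr (2 * \<alpha>)"
proof -
  define \<psi> where "\<psi> = (\<lambda>k. min (\<phi> k) (pi - \<phi> k))"
  let ?h = "\<lambda>t. angle_gap \<tau> n t powr (- \<alpha>)"
  have s: "0 < \<tau> / (exp 1 * real n)" using \<tau> n by simp
  have half: "(\<Sum>k\<in>I. ?h (\<psi> k)) \<le> gap_sum_const \<tau> \<alpha> * real n powr (2 * \<alpha>)"
    if I: "I \<subseteq> J" and dist: "\<And>k l. k \<in> I \<Longrightarrow> l \<in> I \<Longrightarrow> \<bar>\<psi> k - \<psi> l\<bar> = \<bar>\<phi> k - \<phi> l\<bar>" for I
  proof -
    have sep': "\<tau> / (exp 1 * real n) \<le> \<bar>\<psi> k - \<psi> l\<bar>" if "k \<in> I" "l \<in> I" "k \<noteq> l" for k l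
      using sep[of k l] that I dist[of k l] by auto
    then have "inj_on \<psi> I" using s by (intro inj_onI) force
    then have "(\<Sum>k\<in>I. ?h (\<psi> k)) = (\<Sum>t\<in>\<psi> ` I. ?h t)" by (simp add: sum.reindex)
    also have "\<dots> \<le> gap_sum_const \<tau> \<alpha> * real n powr (2 * \<alpha>)"
    proof (rule angle_gap_sum_half[OF _ _ \<tau> \<alpha> n])
      show "finite (\<psi> ` I)" using J I finite_subset by auto
      show "\<psi> ` I \<subseteq> {0..}" using \<phi> I by (auto simp: \<psi>_def)
    qed (use sep' in auto)
    finally show ?thesis .
  qed
  define I0 where "I0 = {k\<in>J. \<phi> k \<le> pi / 2}"
  define I1 where "I1 = {k\<in>J. pi / 2 < \<phi> k}"
  have "(\<Sum>k\<in>J. ?h (\<psi> k)) = (\<Sum>k\<in>I0. ?h (\<psi> k)) + (\<Sum>k\<in>I1. ?h (\<psi> k))"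
  proof -
    have "J = I0 \<union> I1" "I0 \<inter> I1 = {}" by (auto simp: I0_def I1_def)
    moreover have "finite I0" "finite I1" using J by (auto simp: I0_def I1_def)
    ultimately show ?thesis by (simp add: sum.union_disjoint)
  qed
  also have "\<dots> \<le> gap_sum_const \<tau> \<alpha> * real n powr (2 * \<alpha>) + gap_sum_const \<tau> \<alpha> * real n powr (2 * \<alpha>)"
  proof (intro add_mono half)
    show "\<bar>\<psi> k - \<psi> l\<bar> = \<bar>\<phi> k - \<phi> l\<bar>" if "k \<in> I0" "l \<in> I0" for k l
      using that by (simp add: I0_def \<psi>_def min_def)
    show "\<bar>\<psi> k - \<psi> l\<bar> = \<bar>\<phi> k - \<phi> l\<bar>" if "k \<in> I1" "l \<in> I1" for k l
      using that by (simp add: I1_def \<psi>_def min_def)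
  qed (auto simp: I0_def I1_def)
  finally show ?thesis by (simp add: \<psi>_def)
qed

section \<open>From Leja sequences to single basis polynomials\<close>

lemma compact_finite_interval_union:
  assumes "finite_interval_union K"
  shows "compact K" "K \<noteq> {}"
proof -
  obtain I where I: "finite I" "I \<noteq> {}" "\<forall>(a, b)\<in>I. a < b" "K = (\<Union>(a, b)\<in>I. {a..b})"
    using assms unfolding finite_interval_union_def by blast
  show "compact K" unfolding I(4) using I(1) by (intro compact_UN) auto
  obtain a b where "(a, b) \<in> I" using I(2) by auto
  moreover from this have "a \<in> {a..b}" using I(3) by auto
  ultimately show "K \<noteq> {}" unfolding I(4) by blast
qed

text \<open>
  The supremum in the definition may be replaced by the value at any point, as the product is bounded
  on the compact set.
\<close>

lemma leja_inequality:
  assumes "compact K" "x \<in> leja_sequences \<tau> K" "\<tau> \<le> 1" "y \<in> K"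
  shows "\<tau> * (\<Prod>k<n. \<bar>y - x k\<bar>) \<le> (\<Prod>k<n. \<bar>x n - x k\<bar>)"
proof (cases "n = 0")
  case True
  then show ?thesis using assms by simp
next
  case False
  define f where "f = (\<lambda>y. \<Prod>k<n. \<bar>y - x k\<bar>)"
  have sup: "\<tau> * (SUP y\<in>K. f y) \<le> f (x n)"
    using assms(2) False unfolding leja_sequences_def f_def by simp
  have "bdd_above (f ` K)"
    unfolding f_def using assms(1)
    by (intro bounded_imp_bdd_above compact_imp_bounded compact_continuous_image continuous_intros)
  then have y: "f y \<le> (SUP y\<in>K. f y)" using assms(4) by (intro cSUP_upper)
  have "\<tau> * f y \<le> f (x n)"
  proof (cases "0 \<le> \<tau>")
    case True
    then have "\<tau> * f y \<le> \<tau> * (SUP y\<in>K. f y)" using y by (intro mult_left_mono)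
    then show ?thesis using sup by linarith
  next
    case False
    have "0 \<le> f t" for t unfolding f_def by (intro prod_nonneg) auto
    then have "\<tau> * f y \<le> 0" "0 \<le> f (x n)" using False by (auto intro: mult_nonpos_nonneg)
    then show ?thesis by linarith
  qed
  then show ?thesis by (simp add: f_def)
qed

lemma prod_split_at:
  fixes f :: "nat \<Rightarrow> 'a :: comm_monoid_mult"
  shows "(\<Prod>j<Suc k + i. f j) = (\<Prod>j<k. f j) * f k * (\<Prod>l<i. f (Suc k + l))"
  by (induction i) (auto simp: mult_ac)

lemma prod_shift_lessThan:
  fixes f :: "nat \<Rightarrow> 'a :: comm_monoid_mult"
  shows "(\<Prod>j=m..<m + N. f j) = (\<Prod>l<N. f (m + l))"
  by (induction N) auto

text \<open>
  The nodes are translated by \<open>x k\<close>, and the product is split into the nodes before and after \<open>x k\<close>.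
  At \<open>y = x k\<close> the basis polynomial is at most 1 in absolute value.
\<close>

lemma lagrange_basis_bound:
  assumes K: "compact K" and x: "x \<in> leja_sequences \<tau> K" and \<tau>: "0 < \<tau>" "\<tau> \<le> 1"
    and k: "k < n" and d: "0 < d" "d \<le> D"
    and diam: "\<And>s t. s \<in> K \<Longrightarrow> t \<in> K \<Longrightarrow> \<bar>s - t\<bar> \<le> D"
    and far: "\<And>l. k < l \<Longrightarrow> l < n \<Longrightarrow> d \<le> \<bar>x l - x k\<bar>"
    and y: "y \<in> K"
  shows "\<bar>lagrange_basis x n k y\<bar> \<le> 2 / \<tau>\<^sup>2 * (D / d) powr leja_alpha \<tau>"
proof (cases "y = x k")
  case True
  have "\<bar>lagrange_basis x n k y\<bar> \<le> 1 * (1::real)"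
    unfolding mult_1_right lagrange_basis_def True abs_prod by (intro prod_le_1) auto
  also have "1 * (1::real) \<le> 2 / \<tau>\<^sup>2 * (D / d) powr leja_alpha \<tau>"
  proof (intro mult_mono)
    have "\<tau>\<^sup>2 \<le> 1" using \<tau> by (simp add: power_le_one)
    then show "1 \<le> 2 / \<tau>\<^sup>2" using \<tau> by (simp add: field_simps)
    have "0 \<le> leja_alpha \<tau>"
      using leja_theta_pos leja_lambda_pos \<tau> by (simp add: leja_alpha_def one_le_inverse)
    then show "1 \<le> (D / d) powr leja_alpha \<tau>"
      using d by (intro ge_one_powr_ge_zero) auto
  qed auto
  finally show ?thesis .
next
  case False
  define N where "N = n - Suc k"
  define z where "z = (\<lambda>l. x (Suc k + l) - x k)"
  define g where "g = (\<lambda>t. (\<Prod>j<k. \<bar>x k + t - x j\<bar>) / (\<Prod>j<k. \<bar>x k - x j\<bar>))"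
  have xK: "x j \<in> K" for j using x by (simp add: leja_sequences_def)
  have n: "n = Suc k + N" using k by (simp add: N_def)
  have later: "later_nodes {t. x k + t \<in> K} g z N \<tau> d D"
  proof
    show "\<bar>s - t\<bar> \<le> D" if "s \<in> {t. x k + t \<in> K}" "t \<in> {t. x k + t \<in> K}" for s t
      using diam[of "x k + s" "x k + t"] that by simp
    show "0 \<le> g t" for t unfolding g_def by (intro divide_nonneg_nonneg prod_nonneg) auto
    show "g t \<le> 1 / \<tau>" if "t \<in> {t. x k + t \<in> K}" for t
    proof -
      let ?P = "\<Prod>j<k. \<bar>x k - x j\<bar>"
      have "\<tau> * (\<Prod>j<k. \<bar>x k + t - x j\<bar>) \<le> ?P"
        using leja_inequality[OF K x \<tau>(2)] that by simp
      moreover have "0 \<le> ?P" by (intro prod_nonneg) auto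
      ultimately have "(\<tau> * (\<Prod>j<k. \<bar>x k + t - x j\<bar>)) / ?P \<le> ?P / ?P" by (rule divide_right_mono)
      also have "\<dots> \<le> 1" by simp
      finally have "\<tau> * g t \<le> 1" by (simp add: g_def)
      then show ?thesis using \<tau> by (simp add: field_simps)
    qed
    show "d \<le> \<bar>z i\<bar>" if "i < N" for i unfolding z_def using that n by (intro far) auto
    show "\<tau> * (g t * \<bar>t\<bar> * (\<Prod>l<i. \<bar>t - z l\<bar> / \<bar>z l\<bar>))
        \<le> g (z i) * \<bar>z i\<bar> * (\<Prod>l<i. \<bar>z i - z l\<bar> / \<bar>z l\<bar>)"
      if "i < N" "t \<in> {t. x k + t \<in> K}" for i t
    proof -
      define W where "W = (\<Prod>j<k. \<bar>x k - x j\<bar>) * (\<Prod>l<i. \<bar>z l\<bar>)"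
      have W: "0 \<le> W" unfolding W_def by (intro mult_nonneg_nonneg prod_nonneg) auto
      have split: "g t * \<bar>t\<bar> * (\<Prod>l<i. \<bar>t - z l\<bar> / \<bar>z l\<bar>) = (\<Prod>j<Suc k + i. \<bar>x k + t - x j\<bar>) / W" for t
      proof -
        have "\<bar>x k + t - x (Suc k + l)\<bar> = \<bar>t - z l\<bar>" for l by (simp add: z_def)
        then show ?thesis unfolding prod_split_at by (simp add: g_def W_def prod_dividef)
      qed
      have "\<tau> * (\<Prod>j<Suc k + i. \<bar>x k + t - x j\<bar>) \<le> (\<Prod>j<Suc k + i. \<bar>x (Suc k + i) - x j\<bar>)"
        using that by (intro leja_inequality[OF K x \<tau>(2)]) auto
      then have "\<tau> * (\<Prod>j<Suc k + i. \<bar>x k + t - x j\<bar>) / W \<le> (\<Prod>j<Suc k + i. \<bar>x (Suc k + i) - x j\<bar>) / W"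
        using W by (rule divide_right_mono)
      moreover have "x (Suc k + i) = x k + z i" by (simp add: z_def)
      ultimately show ?thesis unfolding split by simp
    qed
  qed (use \<tau> d xK in \<open>auto simp: z_def\<close>)
  have "(\<Prod>j\<in>{..<n} - {k}. \<bar>y - x j\<bar> / \<bar>x k - x j\<bar>)
      = (\<Prod>j<k. \<bar>y - x j\<bar> / \<bar>x k - x j\<bar>) * (\<Prod>l<N. \<bar>y - x k - z l\<bar> / \<bar>z l\<bar>)"
  proof -
    have set: "{..<n} - {k} = {..<k} \<union> {Suc k..<Suc k + N}" using n by auto
    have "(\<Prod>j\<in>{..<n} - {k}. \<bar>y - x j\<bar> / \<bar>x k - x j\<bar>)
        = (\<Prod>j<k. \<bar>y - x j\<bar> / \<bar>x k - x j\<bar>) * (\<Prod>j=Suc k..<Suc k + N. \<bar>y - x j\<bar> / \<bar>x k - x j\<bar>)"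
      unfolding set by (rule prod.union_disjoint) auto
    also have "(\<Prod>j=Suc k..<Suc k + N. \<bar>y - x j\<bar> / \<bar>x k - x j\<bar>)
        = (\<Prod>l<N. \<bar>y - x (Suc k + l)\<bar> / \<bar>x k - x (Suc k + l)\<bar>)"
      by (rule prod_shift_lessThan)
    also have "\<dots> = (\<Prod>l<N. \<bar>y - x k - z l\<bar> / \<bar>z l\<bar>)"
      by (intro prod.cong refl) (simp add: z_def abs_minus_commute)
    finally show ?thesis .
  qed
  then have "\<bar>lagrange_basis x n k y\<bar> = g (y - x k) * (\<Prod>l<N. \<bar>(y - x k) - z l\<bar> / \<bar>z l\<bar>)"
    by (simp add: lagrange_basis_def abs_prod g_def prod_dividef)
  also have "\<dots> \<le> 2 / \<tau>\<^sup>2 * (D / d) powr leja_alpha \<tau>"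
    using y False by (intro later_nodes.basis_le[OF later]) auto
  finally show ?thesis .
qed

section \<open>The spacing of the nodes in an interval\<close>

lemma leja_alpha_gt_1: "0 < \<tau> \<Longrightarrow> \<tau> \<le> 1 \<Longrightarrow> 1 < leja_alpha \<tau>"
  using leja_theta_pos leja_lambda_pos
  by (simp add: leja_alpha_def one_le_inverse add_pos_nonneg)

lemma exp_1_ge: "5/2 \<le> exp (1::real)"
  using exp_lower_Taylor_quadratic[of "1::real"] by simp

definition to_unit :: "real \<Rightarrow> real \<Rightarrow> real \<Rightarrow> real" where
  "to_unit a b t = (2 * t - a - b) / (b - a)"

lemma to_unit_range:
  assumes "a < b" "t \<in> {a..b}"
  shows "-1 \<le> to_unit a b t" "to_unit a b t \<le> 1"
  using assms by (auto simp: to_unit_def field_simps)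

lemma to_unit_diff: "to_unit a b s - to_unit a b t = 2 / (b - a) * (s - t)"
  by (simp add: to_unit_def diff_divide_distrib[symmetric])

text \<open>
  The product over the nodes before \<open>x k\<close> vanishes at \<open>x j\<close> for \<open>j < k\<close>, and its value at \<open>x k\<close> is at least \<open>\<tau>\<close>
  times its maximum on \<open>[a, b]\<close>. That value is positive because the product has only finitely many
  zeros. The product is rescaled to the interval \<open>[-1, 1]\<close>; the nodes outside \<open>[a, b]\<close> are mapped to
  zeros outside \<open>[-1, 1]\<close>.
\<close>

lemma leja_node_separation:
  fixes a b :: real
  defines "T \<equiv> to_unit a b"
  assumes K: "compact K" and x: "x \<in> leja_sequences \<tau> K" and \<tau>: "0 < \<tau>" "\<tau> \<le> 1"
    and ab: "a < b" "{a..b} \<subseteq> K" and j: "j < n" "x j \<in> {a..b}" and k: "k < n" "x k \<in> {a..b}"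
    and "j \<noteq> k"
  shows "\<tau> / (exp 1 * real n) \<le> \<bar>arccos (T (x j)) - arccos (T (x k))\<bar>"
    and "\<tau> / (2 * exp 1 * (real n)\<^sup>2) \<le> \<bar>T (x j) - T (x k)\<bar>"
proof -
  have T_range: "-1 \<le> T t" "T t \<le> 1" if "t \<in> {a..b}" for t
    using to_unit_range[OF ab(1) that] by (simp_all add: T_def)
  have T_diff: "T s - T t = 2 / (b - a) * (s - t)" for s t
    by (simp add: T_def to_unit_diff)
  have main: "\<tau> / (exp 1 * real n) \<le> \<bar>arccos (T (x j)) - arccos (T (x k))\<bar> \<and>
      \<tau> / (2 * exp 1 * (real n)\<^sup>2) \<le> \<bar>T (x j) - T (x k)\<bar>"
    if "j < k" and j: "x j \<in> {a..b}" and k: "k < n" "x k \<in> {a..b}" for j k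
  proof -
    let ?c = "\<lambda>i. T (x i)"
    define P where "P = (\<lambda>t. \<Prod>i<k. \<bar>T t - ?c i\<bar>)"
    have P_eq: "P t = (2 / (b - a)) ^ k * (\<Prod>i<k. \<bar>t - x i\<bar>)" for t
      using ab by (simp only: P_def T_diff abs_mult prod.distrib prod_constant card_lessThan) simp
    have leja: "\<tau> * P t \<le> P (x k)" if "t \<in> {a..b}" for t
    proof -
      have "(2 / (b - a)) ^ k * (\<tau> * (\<Prod>i<k. \<bar>t - x i\<bar>)) \<le> (2 / (b - a)) ^ k * (\<Prod>i<k. \<bar>x k - x i\<bar>)"
        using leja_inequality[OF K x \<tau>(2), of t k] that ab by (intro mult_left_mono) auto
      then show ?thesis by (simp add: P_eq mult_ac)
    qed
    have bound: "(\<Prod>i<k. \<bar>s - ?c i\<bar>) \<le> P (x k) / \<tau>" if "-1 \<le> s" "s \<le> 1" for s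
    proof -
      \<comment> \<open>The preimage of \<open>s\<close> under the rescaling, which lies in \<open>[a, b]\<close>.\<close>
      define t where "t = (a + b) / 2 + (b - a) / 2 * s"
      have "(b - a) / 2 * \<bar>s\<bar> \<le> (b - a) / 2 * 1" using that ab by (intro mult_left_mono) auto
      then have "\<bar>(b - a) / 2 * s\<bar> \<le> (b - a) / 2" using ab by (simp add: abs_mult)
      then have "t \<in> {a..b}" by (auto simp: t_def abs_le_iff field_simps)
      moreover have "T t = s" using ab by (simp add: T_def to_unit_def t_def field_simps)
      ultimately show ?thesis using leja[of t] \<tau> by (simp add: P_def field_simps)
    qed
    have pos: "0 < P (x k) / \<tau>"
    proof (rule ccontr)
      assume "\<not> ?thesis"
      moreover have "0 \<le> P t" for t unfolding P_def by (intro prod_nonneg) auto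
      ultimately have "P (x k) = 0" using \<tau> by (metis divide_pos_pos less_eq_real_def)
      then have "\<tau> * P t \<le> 0" if "t \<in> {a..b}" for t using leja[OF that] by simp
      then have "P t = 0" if "t \<in> {a..b}" for t
        using that \<tau> \<open>0 \<le> P t\<close> by (metis mult_pos_pos not_le order_le_less)
      then have "\<exists>i\<in>{..<k}. t = x i" if "t \<in> {a..b}" for t using that ab by (simp add: P_eq)
      then have "{a..b} \<subseteq> x ` {..<k}" by blast
      then show False using ab(1) by (meson finite_imageI finite_lessThan infinite_Icc finite_subset)
    qed
    have big: "\<tau> * (P (x k) / \<tau>) \<le> (\<Prod>i<k. \<bar>?c k - ?c i\<bar>)" using \<tau> by (simp add: P_def)
    note range = T_range(1)[OF j] T_range(2)[OF j] T_range(1)[OF k(2)] T_range(2)[OF k(2)]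
    have "\<tau> / (exp 1 * real k) \<le> \<bar>arccos (?c j) - arccos (?c k)\<bar>"
      by (rule node_separation_angle[where m = k and c = ?c and M = "P (x k) / \<tau>"])
        (fact bound pos \<open>j < k\<close> range big)+
    moreover have "\<tau> / (2 * exp 1 * (real k)\<^sup>2) \<le> \<bar>?c j - ?c k\<bar>"
      by (rule node_separation_dist[where m = k and c = ?c and M = "P (x k) / \<tau>"])
        (fact bound pos \<open>j < k\<close> range big)+
    moreover have "0 < real k" "real k \<le> real n" using \<open>j < k\<close> k by auto
    moreover from this have "\<tau> / (exp 1 * real n) \<le> \<tau> / (exp 1 * real k)"
        "\<tau> / (2 * exp 1 * (real n)\<^sup>2) \<le> \<tau> / (2 * exp 1 * (real k)\<^sup>2)"
      using \<tau> by (auto intro!: divide_left_mono mult_left_mono mult_pos_pos power_mono)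
    ultimately show ?thesis by linarith
  qed
  show "\<tau> / (exp 1 * real n) \<le> \<bar>arccos (T (x j)) - arccos (T (x k))\<bar>"
    "\<tau> / (2 * exp 1 * (real n)\<^sup>2) \<le> \<bar>T (x j) - T (x k)\<bar>"
    using main[of j k] main[of k j] j k \<open>j \<noteq> k\<close>
    by (auto simp: abs_minus_commute neq_iff)
qed

text \<open>
  The numbers \<open>\<delta> k\<close> are the values of \<open>angle_gap\<close> at the nodes. Near an endpoint they bound the
  distances directly; elsewhere the angular separation is converted by \<open>cos_gap\<close>.
\<close>

lemma interval_node_gaps:
  fixes a b :: real
  assumes K: "compact K" and x: "x \<in> leja_sequences \<tau> K" and \<tau>: "0 < \<tau>" "\<tau> \<le> 1"
    and ab: "a < b" "{a..b} \<subseteq> K" and n: "1 \<le> n" and \<alpha>: "1 < \<alpha>"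
  obtains \<delta> where
    "\<And>k. k < n \<Longrightarrow> x k \<in> {a..b} \<Longrightarrow> 0 < \<delta> k \<and> \<delta> k \<le> 1"
    "\<And>j k. j < n \<Longrightarrow> k < n \<Longrightarrow> j \<noteq> k \<Longrightarrow> x j \<in> {a..b} \<Longrightarrow> x k \<in> {a..b} \<Longrightarrow>
      (b - a) / 2 * \<delta> k \<le> \<bar>x j - x k\<bar>"
    "(\<Sum>k | k < n \<and> x k \<in> {a..b}. \<delta> k powr (- \<alpha>)) \<le> 2 * gap_sum_const \<tau> \<alpha> * real n powr (2 * \<alpha>)"
proof
  define T where "T = to_unit a b"
  define \<phi> where "\<phi> = (\<lambda>k. arccos (T (x k)))"
  define \<psi> where "\<psi> = (\<lambda>k. min (\<phi> k) (pi - \<phi> k))"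
  define s where "s = \<tau> / (exp 1 * real n)"
  let ?\<delta> = "\<lambda>k. angle_gap \<tau> n (\<psi> k)"
  have n0: "1 \<le> real n" using n by simp
  have T_range: "-1 \<le> T (x k)" "T (x k) \<le> 1" if "x k \<in> {a..b}" for k
    using to_unit_range[OF ab(1) that] by (simp_all add: T_def)
  have \<phi>_range: "0 \<le> \<phi> k \<and> \<phi> k \<le> pi" if "x k \<in> {a..b}" for k
    using arccos_bounded[of "T (x k)"] T_range[OF that] by (simp add: \<phi>_def)
  \<comment> \<open>\<open>cos_gap\<close> applies for \<open>\<psi> > 1 / n\<close> because \<open>1 / e \<le> 2/5\<close>.\<close>
  have s_le: "0 < s" "s \<le> 2/5 * (1 / real n)" "s \<le> 2/5"
  proof -
    have "1 / exp 1 \<le> 2/(5::real)" using exp_1_ge by (simp add: field_simps)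
    moreover have "\<tau> / exp 1 \<le> 1 / exp 1" using \<tau> by (intro divide_right_mono) auto
    ultimately have "\<tau> / exp 1 \<le> 2/5" by (rule order_trans[rotated])
    then have "\<tau> / exp 1 * (1 / real n) \<le> 2/5 * (1 / real n)"
      by (intro mult_right_mono) auto
    then show "s \<le> 2/5 * (1 / real n)" by (simp add: s_def)
    also have "\<dots> \<le> 2/5 * 1" using n0 by (intro mult_left_mono) auto
    finally show "s \<le> 2/5" by simp
    show "0 < s" using \<tau> n0 by (simp add: s_def)
  qed
  note sep = leja_node_separation[OF K x \<tau> ab, folded T_def]
  show "0 < ?\<delta> k \<and> ?\<delta> k \<le> 1" if "k < n" "x k \<in> {a..b}" for k
  proof (cases "\<psi> k \<le> 1 / real n")
    case True
    have "\<tau> * 1 \<le> exp 1 * (real n)\<^sup>2"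
      using \<tau> n0 exp_1_ge by (intro mult_mono) auto
    then have "\<tau> \<le> 2 * exp 1 * (real n)\<^sup>2" using \<tau> by linarith
    then show ?thesis using True \<tau> n0 by (simp add: angle_gap_def)
  next
    case False
    have "0 < 1 / real n" using n0 by simp
    then have "0 < \<psi> k" using False by linarith
    have "\<psi> k \<le> pi" using \<phi>_range[OF that(2)] unfolding \<psi>_def by linarith
    then have "s * \<psi> k \<le> 1 * pi" using s_le \<open>0 < \<psi> k\<close> by (intro mult_mono) auto
    then show ?thesis using False \<open>0 < \<psi> k\<close> s_le by (simp add: angle_gap_def flip: s_def)
  qed
  show "(b - a) / 2 * ?\<delta> k \<le> \<bar>x j - x k\<bar>"
    if jk: "j < n" "k < n" "j \<noteq> k" "x j \<in> {a..b}" "x k \<in> {a..b}" for j k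
  proof -
    have "?\<delta> k \<le> \<bar>T (x k) - T (x j)\<bar>"
    proof (cases "\<psi> k \<le> 1 / real n")
      case True
      then show ?thesis using sep(2)[of k n j] jk by (simp add: angle_gap_def)
    next
      case False
      have "s * \<psi> k / pi \<le> \<bar>cos (\<phi> k) - cos (\<phi> j)\<bar>"
        unfolding \<psi>_def
      proof (rule cos_gap)
        show "s \<le> \<bar>\<phi> k - \<phi> j\<bar>" using sep(1)[of k n j] jk by (simp add: \<phi>_def s_def)
        show "s \<le> 2/5 * min (\<phi> k) (pi - \<phi> k)" using s_le(2) False by (simp add: \<psi>_def)
      qed (use \<phi>_range jk s_le in auto)
      then show ?thesis using T_range jk False by (simp add: angle_gap_def \<phi>_def cos_arccos flip: s_def)
    qed
    also have "T (x k) - T (x j) = 2 / (b - a) * (x k - x j)"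
      by (simp add: T_def to_unit_diff)
    finally have "(b - a) / 2 * ?\<delta> k \<le> (b - a) / 2 * \<bar>2 / (b - a) * (x k - x j)\<bar>"
      using ab by (intro mult_left_mono) auto
    also have "\<dots> = \<bar>x k - x j\<bar>" using ab by (simp only: abs_mult) simp
    finally show ?thesis by (simp add: abs_minus_commute)
  qed
  show "(\<Sum>k | k < n \<and> x k \<in> {a..b}. ?\<delta> k powr (- \<alpha>)) \<le> 2 * gap_sum_const \<tau> \<alpha> * real n powr (2 * \<alpha>)"
    unfolding \<psi>_def
  proof (rule angle_gap_sum)
    show "\<tau> / (exp 1 * real n) \<le> \<bar>\<phi> k - \<phi> l\<bar>"
      if "k \<in> {k. k < n \<and> x k \<in> {a..b}}" "l \<in> {k. k < n \<and> x k \<in> {a..b}}" "k \<noteq> l" for k l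
      using sep(1)[of k n l] that by (simp add: \<phi>_def s_def)
  qed (use \<phi>_range \<tau> \<alpha> n in auto)
qed

section \<open>The Lebesgue constants\<close>

text \<open>
  In a representation with the least number of intervals the intervals are pairwise disjoint, since
  two intervals that meet can be merged. Disjoint compact sets have a positive distance.
\<close>

lemma finite_interval_union_separated:
  assumes "finite_interval_union K"
  obtains I :: "(real \<times> real) set" and g :: real where
    "finite I" "I \<noteq> {}" "\<forall>(a, b)\<in>I. a < b" "K = (\<Union>(a, b)\<in>I. {a..b})" "0 < g"
    "\<forall>(a, b)\<in>I. \<forall>s\<in>{a..b}. \<forall>t\<in>K - {a..b}. g \<le> \<bar>s - t\<bar>"
proof -
  define R where "R = (\<lambda>I :: (real \<times> real) set. finite I \<and> I \<noteq> {} \<and> (\<forall>(a, b)\<in>I. a < b) \<and>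
      K = (\<Union>(a, b)\<in>I. {a..b}))"
  obtain I0 where "R I0" using assms unfolding finite_interval_union_def R_def by blast
  then obtain I where I: "R I" and least: "\<And>J. R J \<Longrightarrow> card I \<le> card J"
    using ex_has_least_nat[of R I0 card] by blast
  have fin: "finite I" "I \<noteq> {}" and lt: "\<And>a b. (a, b) \<in> I \<Longrightarrow> a < b"
    and K: "K = (\<Union>(a, b)\<in>I. {a..b})"
    using I unfolding R_def by blast+
  have disj: "{a..b} \<inter> {c..e} = {}" if p: "(a, b) \<in> I" and q: "(c, e) \<in> I" and ne: "(a, b) \<noteq> (c, e)"
    for a b c e
  proof (rule ccontr)
    assume meet: "\<not> ?thesis"
    define I' where "I' = I - {(a, b), (c, e)}"
    define J where "J = insert (min a c, max b e) I'"
    have join: "{min a c..max b e} = {a..b} \<union> {c..e}" using meet by (auto simp: min_def max_def)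
    have "I = {(a, b), (c, e)} \<union> I'" using p q by (auto simp: I'_def)
    then have "K = ({a..b} \<union> {c..e}) \<union> (\<Union>(a, b)\<in>I'. {a..b})" unfolding K by auto
    then have "K = (\<Union>(a, b)\<in>J. {a..b})" by (simp add: J_def join)
    moreover have "\<forall>(a, b)\<in>J. a < b" using lt[OF p] lt by (auto simp: J_def I'_def)
    ultimately have "R J" using fin by (simp add: R_def J_def I'_def)
    then have "card I \<le> card J" by (rule least)
    also have "card J \<le> Suc (card I')" using fin by (simp add: J_def I'_def card_insert_le_m1 card_insert_if)
    also have "card I' = card I - 2" using fin p q ne by (simp add: I'_def card_Diff_subset)
    also have "Suc (card I - 2) < card I"
    proof -
      have "card {(a, b), (c, e)} \<le> card I" using fin p q by (intro card_mono) auto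
      then show ?thesis using ne by auto
    qed
    finally show False by simp
  qed
  have "\<exists>g>0. \<forall>s\<in>{fst p..snd p}. \<forall>t\<in>K - {fst p..snd p}. g \<le> \<bar>s - t\<bar>" if p: "p \<in> I" for p
  proof -
    define U where "U = (\<Union>(a, b)\<in>I - {p}. {a..b})"
    have "closed U" unfolding U_def using fin by (intro closed_UN) auto
    moreover have "{fst p..snd p} \<inter> U = {}"
      using disj[of "fst p" "snd p"] p by (fastforce simp: U_def)
    ultimately obtain g where g: "g > 0" "\<forall>s\<in>{fst p..snd p}. \<forall>t\<in>U. g \<le> dist s t"
      using separate_compact_closed[of "{fst p..snd p}" U] by auto
    have "K - {fst p..snd p} \<subseteq> U" unfolding K U_def by auto
    then show ?thesis using g by (auto simp: dist_real_def subset_iff)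
  qed
  then obtain G where G: "\<And>p. p \<in> I \<Longrightarrow> 0 < G p"
    "\<And>p s t. p \<in> I \<Longrightarrow> s \<in> {fst p..snd p} \<Longrightarrow> t \<in> K - {fst p..snd p} \<Longrightarrow> G p \<le> \<bar>s - t\<bar>"
    by metis
  have G_pos: "0 < Min (G ` I)" using fin G by simp
  have G_le: "Min (G ` I) \<le> \<bar>s - t\<bar>"
    if "(a, b) \<in> I" "s \<in> {a..b}" "t \<in> K - {a..b}" for a b s t
  proof -
    have "Min (G ` I) \<le> G (a, b)" using fin that by (intro Min_le) auto
    also have "\<dots> \<le> \<bar>s - t\<bar>" using that by (intro G(2)) auto
    finally show ?thesis .
  qed
  show thesis by (rule that[OF fin _ K G_pos]) (use lt G_le in blast)+
qed

text \<open>
  Both sides are compared after division by a common factor with \<open>e powr \<alpha>\<close>, the term near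
  the endpoints and the term away from them separately. The constant \<open>1 + e\<close> in \<open>leja_const\<close> where
  \<open>gap_sum_const\<close> has \<open>e\<close> provides the factor \<open>\<rho> = ((1 + e) / e) powr \<alpha>\<close>, which is at least
  \<open>1 + \<alpha> / (1 + e)\<close> and at least \<open>e * \<alpha> / (1 + e)\<close>.
\<close>

lemma gap_sum_const_le_leja_const:
  assumes \<tau>: "0 < \<tau>" "\<tau> \<le> 1"
  shows "2 / \<tau>\<^sup>2 * 2 powr leja_alpha \<tau> * (2 * gap_sum_const \<tau> (leja_alpha \<tau>)) \<le> leja_const \<tau>"
proof -
  define \<alpha> where "\<alpha> = leja_alpha \<tau>"
  define e where "e = exp (1::real)"
  have \<alpha>: "1 < \<alpha>" unfolding \<alpha>_def using \<tau> by (rule leja_alpha_gt_1)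
  have e: "1 \<le> e" by (simp add: e_def)
  define \<rho> where "\<rho> = ((1 + e) / e) powr \<alpha>"
  have ln_ratio: "1 / (1 + e) \<le> ln ((1 + e) / e)"
  proof -
    have "ln (e / (1 + e)) \<le> e / (1 + e) - 1" using e by (intro ln_le_minus_one) auto
    also have "\<dots> = - (1 / (1 + e))" using e by (simp add: field_simps)
    finally show ?thesis using e by (simp add: ln_divide_pos)
  qed
  have \<rho>_exp: "exp (\<alpha> * (1 / (1 + e))) \<le> \<rho>"
    using mult_left_mono[OF ln_ratio, of \<alpha>] \<alpha> e by (simp add: \<rho>_def powr_def)
  have \<rho>1: "1 + \<alpha> / (1 + e) \<le> \<rho>"
    using order_trans[OF exp_ge_add_one_self \<rho>_exp] by simp
  have \<rho>2: "e * (\<alpha> / (1 + e)) \<le> \<rho>"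
  proof -
    have "\<alpha> / (1 + e) \<le> exp (\<alpha> / (1 + e) - 1)" using exp_ge_add_one_self[of "\<alpha> / (1 + e) - 1"] by simp
    then have "e * (\<alpha> / (1 + e)) \<le> e * exp (\<alpha> / (1 + e) - 1)" using e by (intro mult_left_mono) auto
    also have "\<dots> = exp (\<alpha> * (1 / (1 + e)))" by (simp add: e_def flip: exp_add)
    finally show ?thesis using \<rho>_exp by linarith
  qed
  have near: "\<tau> + e \<le> \<rho> * (2 * (1 + e) + \<tau>) / \<alpha>"
  proof -
    have "\<tau> + e \<le> 2 * e" using \<tau> e by simp
    also have "2 * e = e * (\<alpha> / (1 + e)) * (2 * (1 + e)) / \<alpha>"
    proof -
      have cancel: "e * (\<alpha> / q) * (2 * q) / \<alpha> = 2 * e" if "0 < q" for q using that \<alpha> by simp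
      show ?thesis by (rule cancel[symmetric]) (use e in simp)
    qed
    also have "\<dots> \<le> \<rho> * (2 * (1 + e) + \<tau>) / \<alpha>"
      using \<rho>2 \<alpha> e \<tau> by (intro divide_right_mono mult_mono) (auto simp: \<rho>_def)
    finally show ?thesis .
  qed
  have far: "2 * (\<tau> + e / (\<alpha> - 1)) \<le> \<rho> * (2 * (1 + e) + \<tau>) / (\<alpha> - 1)"
  proof -
    have "\<tau> * (\<alpha> - 1) \<le> 1 * (\<alpha> - 1)" using \<tau> \<alpha> by (intro mult_right_mono) auto
    then have "2 * (\<tau> * (\<alpha> - 1) + e) \<le> 2 * (1 + e) + 2 * \<alpha>" by simp
    also have "\<dots> = (1 + \<alpha> / (1 + e)) * (2 * (1 + e))" using e by (simp add: field_simps)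
    also have "\<dots> \<le> \<rho> * (2 * (1 + e) + \<tau>)"
      using \<rho>1 \<alpha> e \<tau> by (intro mult_mono) (auto simp: \<rho>_def)
    finally have "2 * (\<tau> * (\<alpha> - 1) + e) / (\<alpha> - 1) \<le> \<rho> * (2 * (1 + e) + \<tau>) / (\<alpha> - 1)"
      using \<alpha> by (intro divide_right_mono) auto
    moreover have "2 * (\<tau> * (\<alpha> - 1) + e) / (\<alpha> - 1) = 2 * (\<tau> + e / (\<alpha> - 1))"
      using \<alpha> by (simp add: field_simps)
    ultimately show ?thesis by simp
  qed
  \<comment> \<open>The common factor of the two constants.\<close>
  define V where "V = 2 * 2 powr \<alpha> * e powr \<alpha> * \<tau> powr (- \<alpha>) / \<tau> ^ 3"
  have V: "0 \<le> V" using \<tau> by (simp add: V_def)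
  have "2 / \<tau>\<^sup>2 * 2 powr \<alpha> * (2 * gap_sum_const \<tau> \<alpha>)
      = V * (2 * 2 powr \<alpha> * (\<tau> + e) + pi powr \<alpha> * (2 * (\<tau> + e / (\<alpha> - 1))))"
  proof -
    have "(2 * e / \<tau>) powr \<alpha> = 2 powr \<alpha> * e powr \<alpha> * \<tau> powr (- \<alpha>)"
        "(pi * e / \<tau>) powr \<alpha> = pi powr \<alpha> * e powr \<alpha> * \<tau> powr (- \<alpha>)"
      using \<tau> e by (simp_all add: powr_divide powr_mult powr_minus_divide)
    moreover have "1 + e / \<tau> = (\<tau> + e) / \<tau>" "1 + e / (\<tau> * (\<alpha> - 1)) = (\<tau> + e / (\<alpha> - 1)) / \<tau>"
      using \<tau> \<alpha> by (simp_all add: add_divide_distrib mult.commute)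
    moreover have "2 / q\<^sup>2 * p * (2 * (A / q * (p * r * t) + P * r * t * (B / q)))
        = 2 * p * r * t / q ^ 3 * (2 * p * A + P * (2 * B))" for p r t q A B P :: real
      by (simp add: power2_eq_square power3_eq_cube algebra_simps add_divide_distrib)
    ultimately show ?thesis
      unfolding gap_sum_const_def V_def e_def[symmetric] by (simp only:)
  qed
  also have "\<dots> \<le> V * (2 * 2 powr \<alpha> * (\<rho> * (2 * (1 + e) + \<tau>) / \<alpha>) +
      pi powr \<alpha> * (\<rho> * (2 * (1 + e) + \<tau>) / (\<alpha> - 1)))"
    using near far V by (intro mult_left_mono add_mono) auto
  also have "\<dots> = 2 powr (\<alpha> + 1) * (1 + e) powr \<alpha> * (2 * (1 + e) + \<tau>) * \<tau> powr (- (\<alpha> + 3)) *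
      (2 powr (\<alpha> + 1) / \<alpha> + pi powr \<alpha> / (\<alpha> - 1)) * 1"
  proof -
    have "(1 + e) powr \<alpha> = \<rho> * e powr \<alpha>" using e by (simp add: \<rho>_def powr_divide)
    moreover have "\<tau> powr (- (\<alpha> + 3)) = \<tau> powr (- \<alpha>) / \<tau> ^ 3"
      using \<tau> by (simp add: powr_diff powr_realpow)
    moreover have "2 powr (\<alpha> + 1) = 2 * 2 powr \<alpha>" by (simp add: powr_add)
    moreover have "2 * p * r * t / q * (2 * p * (R * m / u) + P * (R * m / v))
        = 2 * p * (R * r) * m * (t / q) * (2 * p / u + P / v) * 1" for p r t q R m P u v :: real
      by (simp add: algebra_simps add_divide_distrib)
    ultimately show ?thesis unfolding V_def by (simp only:)
  qed
  also have "\<dots> \<le> 2 powr (\<alpha> + 1) * (1 + e) powr \<alpha> * (2 * (1 + e) + \<tau>) * \<tau> powr (- (\<alpha> + 3)) *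
      (2 powr (\<alpha> + 1) / \<alpha> + pi powr \<alpha> / (\<alpha> - 1)) *
      ((2 * (1 + e) + 2 * \<tau>) / (2 * (1 + e) + \<tau>)) powr (\<alpha> + 1)"
  proof (rule mult_left_mono)
    have "1 \<le> (2 * (1 + e) + 2 * \<tau>) / (2 * (1 + e) + \<tau>)" using e \<tau> by simp
    then show "1 \<le> ((2 * (1 + e) + 2 * \<tau>) / (2 * (1 + e) + \<tau>)) powr (\<alpha> + 1)"
      using \<alpha> by (intro ge_one_powr_ge_zero) auto
  qed (use e \<tau> \<alpha> in auto)
  also have "\<dots> \<le> leja_const \<tau>"
    unfolding leja_const_def Let_def \<alpha>_def[symmetric] e_def[symmetric] using \<tau> by simp
  finally show ?thesis by (simp add: \<alpha>_def)
qed

lemma lebesgue_constant_le: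
  assumes "K \<noteq> {}" "\<And>y. y \<in> K \<Longrightarrow> (\<Sum>k<n. \<bar>lagrange_basis x n k y\<bar>) \<le> B"
  shows "lebesgue_constant K x n \<le> B"
  unfolding lebesgue_constant_def using assms by (intro cSUP_least) auto

lemma lebesgue_constant_standard_interval:
  assumes x: "x \<in> leja_sequences \<tau> {-1..1}" and \<tau>: "0 < \<tau>" "\<tau> \<le> 1" and n: "1 \<le> n"
  shows "lebesgue_constant {-1..1} x n \<le> leja_const \<tau> * real n powr (2 * leja_alpha \<tau>)"
proof -
  let ?\<alpha> = "leja_alpha \<tau>"
  have xK: "x k \<in> {-1..1}" for k using x by (simp add: leja_sequences_def)
  obtain \<delta> where \<delta>: "\<And>k. k < n \<Longrightarrow> x k \<in> {-1..1} \<Longrightarrow> 0 < \<delta> k \<and> \<delta> k \<le> 1"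
    and gap: "\<And>j k. j < n \<Longrightarrow> k < n \<Longrightarrow> j \<noteq> k \<Longrightarrow> x j \<in> {-1..1} \<Longrightarrow> x k \<in> {-1..1} \<Longrightarrow>
      (1 - (-1)) / 2 * \<delta> k \<le> \<bar>x j - x k\<bar>"
    and sum: "(\<Sum>k | k < n \<and> x k \<in> {-1..1}. \<delta> k powr (- ?\<alpha>))
      \<le> 2 * gap_sum_const \<tau> ?\<alpha> * real n powr (2 * ?\<alpha>)"
    by (rule interval_node_gaps[OF compact_Icc x \<tau> _ order_refl n leja_alpha_gt_1[OF \<tau>]]) auto
  have "{k. k < n \<and> x k \<in> {-1..1}} = {..<n}" using xK by auto
  then have sum': "(\<Sum>k<n. \<delta> k powr (- ?\<alpha>)) \<le> 2 * gap_sum_const \<tau> ?\<alpha> * real n powr (2 * ?\<alpha>)"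
    using sum by simp
  show ?thesis
  proof (rule lebesgue_constant_le)
    fix y :: real assume y: "y \<in> {-1..1}"
    have "\<bar>lagrange_basis x n k y\<bar> \<le> 2 / \<tau>\<^sup>2 * 2 powr ?\<alpha> * \<delta> k powr (- ?\<alpha>)" if k: "k < n" for k
    proof -
      have d: "0 < \<delta> k" "\<delta> k \<le> 2" using \<delta>[OF k xK] by auto
      have "\<bar>lagrange_basis x n k y\<bar> \<le> 2 / \<tau>\<^sup>2 * (2 / \<delta> k) powr ?\<alpha>"
        using gap[of _ k] k xK y by (intro lagrange_basis_bound[OF compact_Icc x \<tau> k d]) auto
      then show ?thesis using d by (simp add: powr_divide powr_minus_divide)
    qed
    then have "(\<Sum>k<n. \<bar>lagrange_basis x n k y\<bar>) \<le> (\<Sum>k<n. 2 / \<tau>\<^sup>2 * 2 powr ?\<alpha> * \<delta> k powr (- ?\<alpha>))"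
      by (intro sum_mono) auto
    also have "\<dots> = 2 / \<tau>\<^sup>2 * 2 powr ?\<alpha> * (\<Sum>k<n. \<delta> k powr (- ?\<alpha>))"
      by (simp only: sum_distrib_left)
    also have "\<dots> \<le> 2 / \<tau>\<^sup>2 * 2 powr ?\<alpha> * (2 * gap_sum_const \<tau> ?\<alpha> * real n powr (2 * ?\<alpha>))"
      using sum' \<tau> by (intro mult_left_mono) auto
    also have "\<dots> = (2 / \<tau>\<^sup>2 * 2 powr ?\<alpha> * (2 * gap_sum_const \<tau> ?\<alpha>)) * real n powr (2 * ?\<alpha>)" by simp
    also have "\<dots> \<le> leja_const \<tau> * real n powr (2 * ?\<alpha>)"
      by (intro mult_right_mono gap_sum_const_le_leja_const \<tau>) auto
    finally show "(\<Sum>k<n. \<bar>lagrange_basis x n k y\<bar>) \<le> leja_const \<tau> * real n powr (2 * ?\<alpha>)" .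
  qed auto
qed

text \<open>
  The nodes are grouped by the interval that contains them. A node in \<open>[a, b]\<close> is at distance at least
  \<open>g\<close> from the nodes outside \<open>[a, b]\<close>, and \<open>(D / min g h) powr \<alpha>\<close> is bounded by the sum of the powers for
  \<open>g\<close> and for \<open>h\<close>.
\<close>

lemma lebesgue_constant_interval_union:
  assumes K: "finite_interval_union K" and \<tau>: "0 < \<tau>" "\<tau> \<le> 1"
  shows "\<exists>C>0. \<forall>x\<in>leja_sequences \<tau> K. \<forall>n\<ge>1.
    lebesgue_constant K x n \<le> C * real n powr (2 * leja_alpha \<tau>)"
proof -
  let ?\<alpha> = "leja_alpha \<tau>"
  have \<alpha>: "1 < ?\<alpha>" using \<tau> by (rule leja_alpha_gt_1)
  have comp: "compact K" "K \<noteq> {}" using compact_finite_interval_union[OF K] by auto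
  obtain I g where I: "finite I" "I \<noteq> {}" "\<forall>(a, b)\<in>I. a < b" "K = (\<Union>(a, b)\<in>I. {a..b})"
    and g: "0 < g" "\<forall>(a, b)\<in>I. \<forall>s\<in>{a..b}. \<forall>t\<in>K - {a..b}. g \<le> \<bar>s - t\<bar>"
    by (rule finite_interval_union_separated[OF K])
  obtain B where B: "\<And>t. t \<in> K \<Longrightarrow> \<bar>t\<bar> \<le> B"
    using compact_imp_bounded[OF comp(1)] by (auto simp: bounded_iff)
  define D where "D = max (2 * B) g"
  have diam: "\<bar>s - t\<bar> \<le> D" if "s \<in> K" "t \<in> K" for s t
    using B[OF that(1)] B[OF that(2)] by (simp add: D_def)
  have D: "0 < D" "g \<le> D" using g by (auto simp: D_def)
  define C where "C = (\<lambda>(a, b). 2 / \<tau>\<^sup>2 * ((D / g) powr ?\<alpha> +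
      (D * 2 / (b - a)) powr ?\<alpha> * (2 * gap_sum_const \<tau> ?\<alpha>)))"
  have "lebesgue_constant K x n \<le> (\<Sum>p\<in>I. C p) * real n powr (2 * ?\<alpha>)"
    if x: "x \<in> leja_sequences \<tau> K" and n: "1 \<le> n" for x n
  proof (rule lebesgue_constant_le[OF comp(2)])
    fix y assume y: "y \<in> K"
    have xK: "x k \<in> K" for k using x by (simp add: leja_sequences_def)
    let ?f = "\<lambda>k. \<bar>lagrange_basis x n k y\<bar>"
    have part: "(\<Sum>k | k < n \<and> x k \<in> {fst p..snd p}. ?f k) \<le> C p * real n powr (2 * ?\<alpha>)"
      if p: "p \<in> I" for p
    proof -
      obtain a b where ab: "p = (a, b)" by (cases p)
      have abI: "(a, b) \<in> I" using p ab by simp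
      have lt: "a < b" using I(3) abI by blast
      have sub: "{a..b} \<subseteq> K" using abI unfolding I(4) by auto
      let ?J = "{k. k < n \<and> x k \<in> {a..b}}"
      obtain \<delta> where \<delta>: "\<And>k. k < n \<Longrightarrow> x k \<in> {a..b} \<Longrightarrow> 0 < \<delta> k \<and> \<delta> k \<le> 1"
        and gap: "\<And>j k. j < n \<Longrightarrow> k < n \<Longrightarrow> j \<noteq> k \<Longrightarrow> x j \<in> {a..b} \<Longrightarrow> x k \<in> {a..b} \<Longrightarrow>
          (b - a) / 2 * \<delta> k \<le> \<bar>x j - x k\<bar>"
        and sum: "(\<Sum>k\<in>?J. \<delta> k powr (- ?\<alpha>)) \<le> 2 * gap_sum_const \<tau> ?\<alpha> * real n powr (2 * ?\<alpha>)"
        by (rule interval_node_gaps[OF comp(1) x \<tau> lt sub n \<alpha>]) (rule that, blast+)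
      have "?f k \<le> 2 / \<tau>\<^sup>2 * ((D / g) powr ?\<alpha> + (D * 2 / (b - a)) powr ?\<alpha> * \<delta> k powr (- ?\<alpha>))"
        if k: "k \<in> ?J" for k
      proof -
        define h where "h = (b - a) / 2 * \<delta> k"
        have \<delta>k: "0 < \<delta> k" using \<delta> k by auto
        have h: "0 < h" using \<delta>k lt by (simp add: h_def)
        define d where "d = min g h"
        have d: "0 < d" "d \<le> D" using g h D by (auto simp: d_def)
        have basis: "?f k \<le> 2 / \<tau>\<^sup>2 * (D / d) powr ?\<alpha>"
        proof (rule lagrange_basis_bound[OF comp(1) x \<tau> _ d diam _ y])
          show "d \<le> \<bar>x l - x k\<bar>" if "k < l" "l < n" for l
          proof (cases "x l \<in> {a..b}")
            case True
            then have "h \<le> \<bar>x l - x k\<bar>" using gap[of l k] that k by (simp add: h_def)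
            then show ?thesis by (simp add: d_def)
          next
            case False
            then have "g \<le> \<bar>x k - x l\<bar>" using g(2) abI xK[of l] k by blast
            then show ?thesis by (simp add: d_def abs_minus_commute)
          qed
        qed (use k in auto)
        have "(D / d) powr ?\<alpha> \<le> (D / g) powr ?\<alpha> + (D / h) powr ?\<alpha>"
          by (cases "g \<le> h") (auto simp: d_def min_def)
        also have "D / h = D * 2 / (b - a) / \<delta> k" by (simp add: h_def)
        also have "(D * 2 / (b - a) / \<delta> k) powr ?\<alpha> = (D * 2 / (b - a)) powr ?\<alpha> * \<delta> k powr (- ?\<alpha>)"
          using \<delta>k lt D powr_divide[of "D * 2 / (b - a)" "\<delta> k" ?\<alpha>]
          by (simp add: powr_minus_divide)
        finally have "2 / \<tau>\<^sup>2 * (D / d) powr ?\<alpha> \<le> 2 / \<tau>\<^sup>2 *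
            ((D / g) powr ?\<alpha> + (D * 2 / (b - a)) powr ?\<alpha> * \<delta> k powr (- ?\<alpha>))"
          by (rule mult_left_mono) simp
        then show ?thesis using basis by linarith
      qed
      then have "(\<Sum>k\<in>?J. ?f k) \<le>
          (\<Sum>k\<in>?J. 2 / \<tau>\<^sup>2 * ((D / g) powr ?\<alpha> + (D * 2 / (b - a)) powr ?\<alpha> * \<delta> k powr (- ?\<alpha>)))"
        by (intro sum_mono) auto
      also have "\<dots> = 2 / \<tau>\<^sup>2 * (real (card ?J) * (D / g) powr ?\<alpha> +
          (D * 2 / (b - a)) powr ?\<alpha> * (\<Sum>k\<in>?J. \<delta> k powr (- ?\<alpha>)))"
        by (simp only: sum_distrib_left[symmetric] sum.distrib sum_constant)
      also have "\<dots> \<le> 2 / \<tau>\<^sup>2 * (real n powr (2 * ?\<alpha>) * (D / g) powr ?\<alpha> +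
          (D * 2 / (b - a)) powr ?\<alpha> * (2 * gap_sum_const \<tau> ?\<alpha> * real n powr (2 * ?\<alpha>)))"
      proof (intro mult_left_mono add_mono mult_right_mono sum)
        have "card ?J \<le> card {..<n}" by (intro card_mono) auto
        then have "real (card ?J) \<le> real n powr 1" using n by simp
        also have "\<dots> \<le> real n powr (2 * ?\<alpha>)" using n \<alpha> by (intro powr_mono) auto
        finally show "real (card ?J) \<le> real n powr (2 * ?\<alpha>)" .
      qed auto
      also have "\<dots> = C p * real n powr (2 * ?\<alpha>)" by (simp add: C_def ab algebra_simps)
      finally show ?thesis by (simp add: ab)
    qed
    have "(\<Sum>k<n. ?f k) \<le> (\<Sum>k<n. \<Sum>p\<in>I. if x k \<in> {fst p..snd p} then ?f k else 0)"
    proof (rule sum_mono)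
      fix k
      obtain p where p: "p \<in> I" "x k \<in> {fst p..snd p}" using xK[of k] unfolding I(4) by force
      have "?f k = (if x k \<in> {fst p..snd p} then ?f k else 0)" using p by simp
      also have "\<dots> \<le> (\<Sum>p\<in>I. if x k \<in> {fst p..snd p} then ?f k else 0)"
        using p I(1) by (intro member_le_sum) auto
      finally show "?f k \<le> (\<Sum>p\<in>I. if x k \<in> {fst p..snd p} then ?f k else 0)" .
    qed
    also have "\<dots> = (\<Sum>p\<in>I. \<Sum>k<n. if x k \<in> {fst p..snd p} then ?f k else 0)"
      by (rule sum.swap)
    also have "\<dots> = (\<Sum>p\<in>I. \<Sum>k | k < n \<and> x k \<in> {fst p..snd p}. ?f k)"
    proof (rule sum.cong[OF refl])
      fix p
      have "{k. k < n \<and> x k \<in> {fst p..snd p}} = {k \<in> {..<n}. x k \<in> {fst p..snd p}}" by auto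
      then show "(\<Sum>k<n. if x k \<in> {fst p..snd p} then ?f k else 0)
          = (\<Sum>k | k < n \<and> x k \<in> {fst p..snd p}. ?f k)"
        by (simp only: sum.inter_filter[OF finite_lessThan])
    qed
    also have "\<dots> \<le> (\<Sum>p\<in>I. C p * real n powr (2 * ?\<alpha>))" by (intro sum_mono part)
    also have "\<dots> = (\<Sum>p\<in>I. C p) * real n powr (2 * ?\<alpha>)" by (simp only: sum_distrib_right)
    finally show "(\<Sum>k<n. ?f k) \<le> (\<Sum>p\<in>I. C p) * real n powr (2 * ?\<alpha>)" .
  qed
  moreover have "0 < (\<Sum>p\<in>I. C p)"
  proof (rule sum_pos[OF I(1,2)])
    have "0 \<le> gap_sum_const \<tau> ?\<alpha>" using \<tau> \<alpha> by (simp add: gap_sum_const_def)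
    then show "0 < C p" for p
      using \<tau> D g by (cases p) (auto simp: C_def intro!: divide_pos_pos add_pos_nonneg)
  qed
  ultimately show ?thesis by blast
qed

theorem theorem1p1:
  fixes K :: "real set" and \<tau> :: real
  assumes "finite_interval_union K" and "0 < \<tau>" and "\<tau> \<le> 1"
  shows "(\<exists>C>0. \<forall>x\<in>leja_sequences \<tau> K. \<forall>n\<ge>1.
            lebesgue_constant K x n \<le> C * real n powr (2 * leja_alpha \<tau>)) \<and>
         (K = {-1..1} \<longrightarrow>
            (\<forall>x\<in>leja_sequences \<tau> K. \<forall>n\<ge>1.
               lebesgue_constant K x n \<le> leja_const \<tau> * real n powr (2 * leja_alpha \<tau>)))"
  using lebesgue_constant_interval_union[OF assms]
    lebesgue_constant_standard_interval[OF _ assms(2,3)] by blast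

thm_deps theorem1p1

end
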